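(* Let $k,n,m$ be integers with $1\leq k<n$ and $m\geq 1$, and let $R_k : M_n\to M_n$ be the linear map $R_k(X)=k\,\mathrm{Tr}(X)I_n - X$. Then \[ \nu_m(R_k)=\lceil m/k\rceil -1 \quad\text{and}\quad \nu(R_k)=1/k. \]
   Context: $M_n$ is the set of $n\times n$ complex matrices. A density matrix is a positive semidefinite matrix with trace $1$. $A\succeq O$ means that $A$ is positive semidefinite. The support of a Hermitian matrix is its range. $I_m\otimes\Phi$ acts as the identity map on $M_m$ tensored with $\Phi$. For a Hermiticity-preserving linear map $\Phi$ on $M_n$ (one sending Hermitian matrices to Hermitian matrices), $\nu_m(\Phi)$ is the maximum of $\dim(\mathcal{S})$ over all subspaces $\mathcal{S}\subseteq\mathbb{C}^m\otimes\mathbb{C}^n$ such that $(I_m\otimes\Phi)(\rho)\not\succeq O$ for every density matrix $\rho\in M_m\otimes M_n$ with support contained in $\mathcal{S}$; and $\nu(\Phi)=\lim_{m\to\infty}\nu_m(\Phi)/m$ (this limit always exists). *)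

theory Defs
  imports "Jordan_Normal_Form.Schur_Decomposition"
begin

definition hermitian_mat :: "nat \<Rightarrow> complex mat \<Rightarrow> bool" where
  "hermitian_mat N A \<longleftrightarrow> A \<in> carrier_mat N N \<and> mat_adjoint A = A"

(* For a Hermitian matrix the quadratic form is real, so nothing is lost by taking Re. *)
definition psd_mat :: "nat \<Rightarrow> complex mat \<Rightarrow> bool" where
  "psd_mat N A \<longleftrightarrow>
     hermitian_mat N A \<and> (\<forall>v \<in> carrier_vec N. 0 \<le> Re ((A *\<^sub>v v) \<bullet>c v))"

definition mat_tr :: "complex mat \<Rightarrow> complex" where
  "mat_tr A = (\<Sum>i<dim_row A. A $$ (i,i))"

definition density_mat :: "nat \<Rightarrow> complex mat \<Rightarrow> bool" where
  "density_mat N \<rho> \<longleftrightarrow> psd_mat N \<rho> \<and> mat_tr \<rho> = 1"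

definition mat_range :: "complex mat \<Rightarrow> complex vec set" where
  "mat_range A = (\<lambda>v. A *\<^sub>v v) ` carrier_vec (dim_col A)"

(* C^m (x) C^n is identified with C^(m*n) by sending e_i (x) e_a to e_(i*n+a); accordingly
   M_m (x) M_n is carrier_mat (m*n) (m*n), and the tensor product of matrices is the
   Kronecker product. *)
definition kronecker :: "complex mat \<Rightarrow> complex mat \<Rightarrow> complex mat" where
  "kronecker A B = mat (dim_row A * dim_row B) (dim_col A * dim_col B)
     (\<lambda>(r,c). A $$ (r div dim_row B, c div dim_col B) * B $$ (r mod dim_row B, c mod dim_col B))"

definition mat_block :: "nat \<Rightarrow> complex mat \<Rightarrow> nat \<Rightarrow> nat \<Rightarrow> complex mat" where
  "mat_block n X i j = mat n n (\<lambda>(a,b). X $$ (i * n + a, j * n + b))"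

(* The map I_m (x) Phi: it applies Phi to each of the m*m blocks of size n*n.
   The lemmas id_tensor_kronecker, id_tensor_add and id_tensor_smult show that, for Phi linear,
   this is the linear map sending A (x) B to A (x) Phi(B). *)
definition id_tensor :: "nat \<Rightarrow> nat \<Rightarrow> (complex mat \<Rightarrow> complex mat) \<Rightarrow> complex mat \<Rightarrow> complex mat" where
  "id_tensor m n \<Phi> X = mat (m * n) (m * n)
     (\<lambda>(r,c). \<Phi> (mat_block n X (r div n) (c div n)) $$ (r mod n, c mod n))"

definition linear_mat_map :: "nat \<Rightarrow> (complex mat \<Rightarrow> complex mat) \<Rightarrow> bool" where
  "linear_mat_map n \<Phi> \<longleftrightarrow>
     (\<forall>X \<in> carrier_mat n n. \<Phi> X \<in> carrier_mat n n) \<and>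
     (\<forall>X \<in> carrier_mat n n. \<forall>Y \<in> carrier_mat n n. \<Phi> (X + Y) = \<Phi> X + \<Phi> Y) \<and>
     (\<forall>c. \<forall>X \<in> carrier_mat n n. \<Phi> (c \<cdot>\<^sub>m X) = c \<cdot>\<^sub>m \<Phi> X)"

definition hermiticity_preserving :: "nat \<Rightarrow> (complex mat \<Rightarrow> complex mat) \<Rightarrow> bool" where
  "hermiticity_preserving n \<Phi> \<longleftrightarrow> (\<forall>X. hermitian_mat n X \<longrightarrow> hermitian_mat n (\<Phi> X))"

abbreviation is_subspace :: "nat \<Rightarrow> complex vec set \<Rightarrow> bool" where
  "is_subspace N S \<equiv> VectorSpace.subspace class_ring S (module_vec TYPE(complex) N)"

abbreviation subspace_dim :: "nat \<Rightarrow> complex vec set \<Rightarrow> nat" where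
  "subspace_dim N S \<equiv> vectorspace.dim class_ring ((module_vec TYPE(complex) N)\<lparr>carrier := S\<rparr>)"

definition detecting_subspace ::
    "nat \<Rightarrow> nat \<Rightarrow> (complex mat \<Rightarrow> complex mat) \<Rightarrow> complex vec set \<Rightarrow> bool" where
  "detecting_subspace m n \<Phi> S \<longleftrightarrow>
     is_subspace (m * n) S \<and>
     (\<forall>\<rho>. density_mat (m * n) \<rho> \<and> mat_range \<rho> \<subseteq> S \<longrightarrow> \<not> psd_mat (m * n) (id_tensor m n \<Phi> \<rho>))"

(* nu_m and nu are meant for Phi linear and Hermiticity-preserving on M_n. The set below is
   finite and nonempty for every Phi (lemmas finite_detecting_dims and
   detecting_dims_nonempty), so Max is a genuine maximum. *)
definition nu_m :: "nat \<Rightarrow> nat \<Rightarrow> (complex mat \<Rightarrow> complex mat) \<Rightarrow> nat" where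
  "nu_m m n \<Phi> = Max {subspace_dim (m * n) S | S. detecting_subspace m n \<Phi> S}"

definition nu :: "nat \<Rightarrow> (complex mat \<Rightarrow> complex mat) \<Rightarrow> real" where
  "nu n \<Phi> = lim (\<lambda>m. real (nu_m m n \<Phi>) / real m)"

definition R_map :: "nat \<Rightarrow> nat \<Rightarrow> complex mat \<Rightarrow> complex mat" where
  "R_map k n X = (of_nat k * mat_tr X) \<cdot>\<^sub>m 1\<^sub>m n - X"


lemma mat_adjoint_index:
  assumes "A \<in> carrier_mat N N" "i < N" "j < N"
  shows "mat_adjoint A $$ (i,j) = cnj (A $$ (j,i))"
  using assms unfolding mat_adjoint_def
  by (auto simp: mat_of_rows_def conjugate_vec_def)

lemma mat_adjoint_carrier:
  assumes "A \<in> carrier_mat N N"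
  shows "mat_adjoint A \<in> carrier_mat N N"
  using assms unfolding mat_adjoint_def by auto

lemma hermitian_mat_iff:
  "hermitian_mat N A \<longleftrightarrow> A \<in> carrier_mat N N \<and> (\<forall>i<N. \<forall>j<N. A $$ (i,j) = cnj (A $$ (j,i)))"
proof (cases "A \<in> carrier_mat N N")
  case True
  have "mat_adjoint A = A \<longleftrightarrow> (\<forall>i<N. \<forall>j<N. mat_adjoint A $$ (i,j) = A $$ (i,j))"
    using True mat_adjoint_carrier[OF True] by (auto simp: mat_eq_iff)
  then show ?thesis
    using True mat_adjoint_index[OF True] unfolding hermitian_mat_def by metis
qed (simp add: hermitian_mat_def)

lemma linear_R_map: "linear_mat_map n (R_map k n)"
proof -
  have "mat_tr (X + Y) = mat_tr X + mat_tr Y"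
    if "X \<in> carrier_mat n n" "Y \<in> carrier_mat n n" for X Y
    using that by (auto simp: mat_tr_def sum.distrib)
  moreover have "mat_tr (c \<cdot>\<^sub>m X) = c * mat_tr X" if "X \<in> carrier_mat n n" for c X
    using that by (auto simp: mat_tr_def sum_distrib_left)
  moreover have "R_map k n X \<in> carrier_mat n n" if "X \<in> carrier_mat n n" for X
    using that by (simp add: R_map_def minus_carrier_mat)
  ultimately show ?thesis
    unfolding linear_mat_map_def
    by (auto simp: R_map_def algebra_simps intro!: eq_matI)
qed

lemma hermiticity_preserving_R_map: "hermiticity_preserving n (R_map k n)"
proof -
  have "hermitian_mat n (R_map k n X)" if "hermitian_mat n X" for X
  proof -
    have X: "X \<in> carrier_mat n n"
      and h: "\<And>i j. i < n \<Longrightarrow> j < n \<Longrightarrow> cnj (X $$ (i,j)) = X $$ (j,i)"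
      using that unfolding hermitian_mat_iff by metis+
    have "cnj (mat_tr X) = mat_tr X"
      using X h by (auto simp: mat_tr_def intro!: sum.cong)
    then show ?thesis
      using X h unfolding hermitian_mat_iff R_map_def by auto
  qed
  then show ?thesis unfolding hermiticity_preserving_def by blast
qed

lemma block_index_less:
  fixes r m n :: nat
  assumes "r < m * n"
  shows "r div n < m" "r mod n < n" "0 < n"
proof -
  show "0 < n" using assms by (cases n) auto
  then show "r mod n < n" by simp
  show "r div n < m" using assms by (rule less_mult_imp_div_less)
qed

lemma mat_index_less:
  fixes i a m n :: nat
  assumes "i < m" "a < n"
  shows "i * n + a < m * n"
proof -
  have "i * n + a < Suc i * n" using assms(2) by simp
  also have "\<dots> \<le> m * n" using assms(1) by (intro mult_le_mono1) simp
  finally show ?thesis .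
qed

lemma id_tensor_kronecker:
  assumes lin: "linear_mat_map n \<Phi>"
    and A: "A \<in> carrier_mat m m" and B: "B \<in> carrier_mat n n"
  shows "id_tensor m n \<Phi> (kronecker A B) = kronecker A (\<Phi> B)"
proof -
  have PB: "\<Phi> B \<in> carrier_mat n n" using lin B unfolding linear_mat_map_def by blast
  have blk: "mat_block n (kronecker A B) i j = A $$ (i,j) \<cdot>\<^sub>m B" if "i < m" "j < m" for i j
    using that A B by (auto simp: mat_block_def kronecker_def mat_index_less intro!: eq_matI)
  have "\<Phi> (A $$ (i,j) \<cdot>\<^sub>m B) = A $$ (i,j) \<cdot>\<^sub>m \<Phi> B" for i j
    using lin B unfolding linear_mat_map_def by blast
  then show ?thesis
    using A B PB blk
    by (intro eq_matI) (auto simp: id_tensor_def kronecker_def block_index_less)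
qed

lemma id_tensor_add:
  assumes lin: "linear_mat_map n \<Phi>"
    and X: "X \<in> carrier_mat (m * n) (m * n)" and Y: "Y \<in> carrier_mat (m * n) (m * n)"
  shows "id_tensor m n \<Phi> (X + Y) = id_tensor m n \<Phi> X + id_tensor m n \<Phi> Y"
proof -
  have blk: "mat_block n (X + Y) i j = mat_block n X i j + mat_block n Y i j"
    if "i < m" "j < m" for i j
    using that X Y by (auto simp: mat_block_def mat_index_less intro!: eq_matI)
  have c: "mat_block n Z i j \<in> carrier_mat n n" for Z i j by (simp add: mat_block_def)
  have "\<Phi> (mat_block n X i j + mat_block n Y i j) = \<Phi> (mat_block n X i j) + \<Phi> (mat_block n Y i j)"
    "\<Phi> (mat_block n Y i j) \<in> carrier_mat n n" for i j
    using lin c unfolding linear_mat_map_def by blast+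
  note P = this(1) carrier_matD[OF this(2)]
  show ?thesis
    using blk P by (intro eq_matI) (auto simp: id_tensor_def block_index_less)
qed

lemma id_tensor_smult:
  assumes lin: "linear_mat_map n \<Phi>"
    and X: "X \<in> carrier_mat (m * n) (m * n)"
  shows "id_tensor m n \<Phi> (c \<cdot>\<^sub>m X) = c \<cdot>\<^sub>m id_tensor m n \<Phi> X"
proof -
  have blk: "mat_block n (c \<cdot>\<^sub>m X) i j = c \<cdot>\<^sub>m mat_block n X i j"
    if "i < m" "j < m" for i j
    using that X by (auto simp: mat_block_def mat_index_less intro!: eq_matI)
  have c: "mat_block n Z i j \<in> carrier_mat n n" for Z i j by (simp add: mat_block_def)
  have "\<Phi> (c \<cdot>\<^sub>m mat_block n X i j) = c \<cdot>\<^sub>m \<Phi> (mat_block n X i j)"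
    "\<Phi> (mat_block n X i j) \<in> carrier_mat n n" for i j
    using lin c unfolding linear_mat_map_def by blast+
  note P = this(1) carrier_matD[OF this(2)]
  show ?thesis
    using blk P by (intro eq_matI) (auto simp: id_tensor_def block_index_less)
qed

lemma subspace_dim_le:
  assumes "is_subspace N S"
  shows "subspace_dim N S \<le> N"
proof -
  interpret vec_space "TYPE(complex)" N .
  interpret W: vectorspace class_ring "vs S" using subspace_is_vs[OF assms] .
  have sub: "S \<subseteq> carrier_vec N" using assms
    by (auto simp: VectorSpace.subspace_def submodule_def)
  have bound: "finite B \<and> card B \<le> N" if "B \<subseteq> S" "W.lin_indpt B" for B
  proof -
    have "lin_indpt B"
      using that span_li_not_depend(2)[of B S] assms unfolding VectorSpace.subspace_def by blast
    then show ?thesis using li_le_dim[of B] that sub fin_dim dim_is_n by auto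
  qed
  have "\<exists>B. finite B \<and> maximal B (\<lambda>U. U \<subseteq> carrier (vs S) \<and> W.lin_indpt U)"
    using bound
    by (intro maximal_exists[where N = N and B = "{}"]) (auto simp: W.lin_dep_def)
  then obtain B where B: "finite B" "maximal B (\<lambda>U. U \<subseteq> carrier (vs S) \<and> W.lin_indpt U)" by blast
  then have "W.basis B" using W.max_li_is_basis by blast
  then have "W.dim = card B" using W.dim_basis B(1) by blast
  moreover have "card B \<le> N" using B bound unfolding maximal_def by auto
  ultimately show ?thesis by simp
qed

lemma finite_detecting_dims: "finite {subspace_dim (m * n) S | S. detecting_subspace m n \<Phi> S}"
  by (rule finite_subset[of _ "{..m * n}"])
    (auto simp: detecting_subspace_def intro: subspace_dim_le)

lemma detecting_dims_nonempty:
  "{subspace_dim (m * n) S | S. detecting_subspace m n \<Phi> S} \<noteq> {}"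
proof -
  let ?N = "m * n"
  interpret vec_space "TYPE(complex)" ?N .
  have "is_subspace ?N {0\<^sub>v ?N}"
    using span_is_subspace[of "{}"] by (simp add: span_empty)
  moreover have "\<not> mat_range \<rho> \<subseteq> {0\<^sub>v ?N}" if "density_mat ?N \<rho>" for \<rho>
  proof
    assume z: "mat_range \<rho> \<subseteq> {0\<^sub>v ?N}"
    have c: "\<rho> \<in> carrier_mat ?N ?N"
      using that unfolding density_mat_def psd_mat_def hermitian_mat_def by blast
    have "\<rho> $$ (i,i) = 0" if i: "i < ?N" for i
    proof -
      have "\<rho> *\<^sub>v unit_vec ?N i = 0\<^sub>v ?N" using z unit_vec_carrier[of ?N i]
        unfolding mat_range_def carrier_matD(2)[OF c] by blast
      moreover have "(\<rho> *\<^sub>v unit_vec ?N i) $ i = \<rho> $$ (i,i)" using c i by auto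
      ultimately show ?thesis using i by simp
    qed
    then have "mat_tr \<rho> = 0" using c by (auto simp: mat_tr_def)
    then show False using that unfolding density_mat_def by simp
  qed
  ultimately show ?thesis unfolding detecting_subspace_def by blast
qed

end

theory Submission
  imports Defs "HOL-Analysis.Function_Topology" "Jordan_Normal_Form.DL_Rank"
begin

text \<open>
  On density matrices the map is \<open>R(\<rho>) = k (Tr\<^sub>2 \<rho> \<otimes> I) - \<rho>\<close>, which is self-adjoint for the trace pairing.

  Upper bound: let \<open>S\<close> be a detecting subspace of dimension \<open>d\<close>. Then the compact convex set of all
  \<open>R(\<rho>) - Z\<close>, with \<open>\<rho>\<close> supported in \<open>S\<close>, \<open>Z\<close> positive semidefinite and the parameters of total trace
  one, misses the origin, so its point of minimal norm yields a positive definite \<open>Y\<close> whose form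
  exceeds \<open>k (T \<otimes> I)\<close> on \<open>S - {0}\<close>, where \<open>T = Tr\<^sub>2 Y\<close>. Taking the trace of \<open>Y\<close> over \<open>S\<close> with respect
  to the inner product \<open>T \<otimes> I\<close> gives more than \<open>k d\<close>, while the same trace over the whole space is
  \<open>tr (T T\<^sup>-\<^sup>1) = m\<close>. Hence \<open>k d < m\<close>.

  Lower bound: if \<open>d k < m\<close>, there are orthogonal vectors \<open>x\<^sub>0, \<dots>, x\<^bsub>d-1\<^esub>\<close> of squared norm \<open>d k + 1\<close>,
  each of Schmidt rank \<open>k + 1\<close>, such that \<open>Y = \<Sum> x\<^sub>i x\<^sub>i\<^sup>*\<close> has partial trace \<open>\<le> d I\<close>. For a density
  matrix supported in their span, \<open>tr (Y R(\<rho>)) \<le> k d - (d k + 1) < 0\<close>, so \<open>R(\<rho>)\<close> is not positive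
  semidefinite.
\<close>

section \<open>Quadratic forms\<close>

definition qform :: "complex mat \<Rightarrow> complex vec \<Rightarrow> real" where
  "qform A v = Re ((A *\<^sub>v v) \<bullet>c v)"

definition pd_mat :: "nat \<Rightarrow> complex mat \<Rightarrow> bool" where
  "pd_mat N A \<longleftrightarrow> hermitian_mat N A \<and> (\<forall>v \<in> carrier_vec N. v \<noteq> 0\<^sub>v N \<longrightarrow> 0 < qform A v)"

definition outer :: "complex vec \<Rightarrow> complex mat" where
  "outer x = mat (dim_vec x) (dim_vec x) (\<lambda>(i,j). x $ i * cnj (x $ j))"

lemma outer_carrier [simp]: "x \<in> carrier_vec N \<Longrightarrow> outer x \<in> carrier_mat N N"
  by (simp add: outer_def)

lemma psd_mat_qform: "psd_mat N A \<longleftrightarrow> hermitian_mat N A \<and> (\<forall>v \<in> carrier_vec N. 0 \<le> qform A v)"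
  by (simp add: psd_mat_def qform_def)

lemma hermitian_carrier: "hermitian_mat N A \<Longrightarrow> A \<in> carrier_mat N N"
  by (simp add: hermitian_mat_def)

lemma psd_carrier: "psd_mat N A \<Longrightarrow> A \<in> carrier_mat N N"
  by (simp add: psd_mat_def hermitian_mat_def)

lemma pd_carrier: "pd_mat N A \<Longrightarrow> A \<in> carrier_mat N N"
  by (simp add: pd_mat_def hermitian_mat_def)

lemma pd_imp_psd: "pd_mat N A \<Longrightarrow> psd_mat N A"
  unfolding pd_mat_def psd_mat_qform
proof (intro conjI ballI)
  fix v :: "complex vec" assume *: "hermitian_mat N A \<and> (\<forall>v\<in>carrier_vec N. v \<noteq> 0\<^sub>v N \<longrightarrow> 0 < qform A v)"
    "v \<in> carrier_vec N"
  then have "A \<in> carrier_mat N N" by (simp add: hermitian_carrier)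
  then show "0 \<le> qform A v" using * by (cases "v = 0\<^sub>v N") (auto simp: qform_def less_imp_le)
qed auto

text \<open>The form is linear in \<open>v\<close> and conjugate linear in \<open>w\<close>, since
  \<open>\<bullet>c\<close> conjugates its second argument. Most identities below are checked on
  this double sum.\<close>

lemma sesq_sum:
  fixes A :: "complex mat"
  assumes "A \<in> carrier_mat N M" "v \<in> carrier_vec M" "w \<in> carrier_vec N"
  shows "(A *\<^sub>v v) \<bullet>c w = (\<Sum>i<N. \<Sum>j<M. A $$ (i,j) * v $ j * cnj (w $ i))"
  using assms
  by (auto simp: scalar_prod_def sum_distrib_right atLeast0LessThan intro!: sum.cong)

lemma qform_sum:
  assumes "A \<in> carrier_mat N N" "v \<in> carrier_vec N"
  shows "qform A v = Re (\<Sum>i<N. \<Sum>j<N. A $$ (i,j) * v $ j * cnj (v $ i))"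
  using sesq_sum[OF assms(1) assms(2) assms(2)] by (simp add: qform_def)

lemma mat_tr_mult:
  assumes "A \<in> carrier_mat N M" "B \<in> carrier_mat M N"
  shows "mat_tr (A * B) = (\<Sum>i<N. \<Sum>j<M. A $$ (i,j) * B $$ (j,i))"
  using assms by (auto simp: mat_tr_def scalar_prod_def atLeast0LessThan intro!: sum.cong)

lemma mat_tr_comm:
  assumes "A \<in> carrier_mat N M" "B \<in> carrier_mat M N"
  shows "mat_tr (A * B) = mat_tr (B * A)"
  unfolding mat_tr_mult[OF assms] mat_tr_mult[OF assms(2,1)]
  by (subst sum.swap) (simp add: mult.commute)

lemma mat_tr_add:
  assumes "A \<in> carrier_mat N N" "B \<in> carrier_mat N N"
  shows "mat_tr (A + B) = mat_tr A + mat_tr B"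
  using assms by (auto simp: mat_tr_def sum.distrib)

lemma mat_tr_minus:
  assumes "A \<in> carrier_mat N N" "B \<in> carrier_mat N N"
  shows "mat_tr (A - B) = mat_tr A - mat_tr B"
  using assms by (auto simp: mat_tr_def sum_subtractf)

lemma mat_tr_smult: "mat_tr (c \<cdot>\<^sub>m A) = c * mat_tr A" if "A \<in> carrier_mat N N"
  using that by (auto simp: mat_tr_def sum_distrib_left)

lemma mat_tr_mult_outer:
  assumes "A \<in> carrier_mat N N" "x \<in> carrier_vec N"
  shows "mat_tr (A * outer x) = (A *\<^sub>v x) \<bullet>c x"
  unfolding mat_tr_mult[OF assms(1) outer_carrier[OF assms(2)]] sesq_sum[OF assms(1,2,2)]
  using assms by (auto simp: outer_def intro!: sum.cong)

text \<open>Evaluating a form at a vector is pairing with a rank one matrix under the trace; this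
  translates conditions on vectors into conditions on traces and back.\<close>

lemma qform_outer: "A \<in> carrier_mat N N \<Longrightarrow> x \<in> carrier_vec N \<Longrightarrow> qform A x = Re (mat_tr (A * outer x))"
  by (simp add: mat_tr_mult_outer qform_def)

section \<open>Adjoints of rectangular matrices, Hermitian forms, Cauchy-Schwarz\<close>

lemma adjoint_index:
  fixes A :: "complex mat"
  assumes "A \<in> carrier_mat N M" "i < M" "j < N"
  shows "mat_adjoint A $$ (i,j) = cnj (A $$ (j,i))"
  using assms unfolding mat_adjoint_def
  by (auto simp: mat_of_rows_def conjugate_vec_def)

lemma adjoint_carrier [simp]:
  "A \<in> carrier_mat N M \<Longrightarrow> mat_adjoint A \<in> carrier_mat M N"
  unfolding mat_adjoint_def by auto

lemma adjoint_dim [simp]: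
  fixes A :: "complex mat"
  shows "dim_row (mat_adjoint A) = dim_col A" "dim_col (mat_adjoint A) = dim_row A"
  by (auto simp: mat_adjoint_def)

lemma adjoint_entry [simp]:
  fixes A :: "complex mat"
  assumes "i < dim_col A" "j < dim_row A"
  shows "mat_adjoint A $$ (i,j) = cnj (A $$ (j,i))"
  using assms by (intro adjoint_index) auto

lemma adjoint_mult:
  fixes A B :: "complex mat"
  assumes A: "A \<in> carrier_mat N M" and B: "B \<in> carrier_mat M K"
  shows "mat_adjoint (A * B) = mat_adjoint B * mat_adjoint A"
  using assms by (intro eq_matI) (auto simp: scalar_prod_def mult.commute intro!: sum.cong)

lemma adjoint_sesq:
  fixes A :: "complex mat"
  assumes A: "A \<in> carrier_mat N M" and v: "v \<in> carrier_vec M" and w: "w \<in> carrier_vec N"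
  shows "(A *\<^sub>v v) \<bullet>c w = v \<bullet>c (mat_adjoint A *\<^sub>v w)"
proof -
  have "v \<bullet>c (mat_adjoint A *\<^sub>v w) = (\<Sum>j<M. \<Sum>i<N. v $ j * (A $$ (i,j) * cnj (w $ i)))"
    using assms by (auto simp: scalar_prod_def sum_distrib_left atLeast0LessThan intro!: sum.cong)
  then show ?thesis unfolding sesq_sum[OF assms]
    by (subst sum.swap) (simp add: mult_ac)
qed

lemma hermitian_sesq:
  assumes A: "hermitian_mat N A" and v: "v \<in> carrier_vec N" and w: "w \<in> carrier_vec N"
  shows "(A *\<^sub>v v) \<bullet>c w = cnj ((A *\<^sub>v w) \<bullet>c v)"
proof -
  have c: "A \<in> carrier_mat N N" and h: "\<And>i j. i < N \<Longrightarrow> j < N \<Longrightarrow> cnj (A $$ (i,j)) = A $$ (j,i)"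
    using A unfolding hermitian_mat_iff by metis+
  have "cnj ((A *\<^sub>v w) \<bullet>c v) = (\<Sum>i<N. \<Sum>j<N. A $$ (j,i) * v $ i * cnj (w $ j))"
    unfolding sesq_sum[OF c w v] using h by (auto intro!: sum.cong)
  then show ?thesis unfolding sesq_sum[OF c v w] by (subst sum.swap) simp
qed

text \<open>The two cross terms of the expansion are conjugate, so their real parts agree. A free
  coefficient \<open>c\<close> yields Cauchy-Schwarz; \<open>c = 1\<close> is used later to complete
  a square.\<close>

lemma qform_diff:
  assumes A: "hermitian_mat N A" and v: "v \<in> carrier_vec N" and w: "w \<in> carrier_vec N"
  shows "qform A (v - c \<cdot>\<^sub>v w) = qform A v - 2 * Re (cnj c * ((A *\<^sub>v v) \<bullet>c w)) + (cmod c)\<^sup>2 * qform A w"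
proof -
  have cA: "A \<in> carrier_mat N N" using A by (rule hermitian_carrier)
  let ?h = "\<lambda>v w. (A *\<^sub>v v) \<bullet>c w"
  have "?h (v - c \<cdot>\<^sub>v w) (v - c \<cdot>\<^sub>v w) = ?h v v - cnj c * ?h v w - c * ?h w v + c * cnj c * ?h w w"
  proof -
    let ?S = "\<lambda>v w. \<Sum>i<N. \<Sum>j<N. A $$ (i,j) * v $ j * cnj (w $ i)"
    have "?S (v - c \<cdot>\<^sub>v w) (v - c \<cdot>\<^sub>v w) = (\<Sum>i<N. \<Sum>j<N. A $$ (i,j) * v $ j * cnj (v $ i)
        - cnj c * (A $$ (i,j) * v $ j * cnj (w $ i)) - c * (A $$ (i,j) * w $ j * cnj (v $ i))
        + c * cnj c * (A $$ (i,j) * w $ j * cnj (w $ i)))"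
      using v w by (intro sum.cong refl) (simp add: algebra_simps)
    also have "\<dots> = ?S v v - cnj c * ?S v w - c * ?S w v + c * cnj c * ?S w w"
      by (simp add: sum.distrib sum_subtractf sum_distrib_left)
    finally show ?thesis using v w by (simp add: sesq_sum[OF cA])
  qed
  moreover have "Re (c * ?h w v) = Re (cnj c * ?h v w)"
    by (subst hermitian_sesq[OF A w v]) (simp add: algebra_simps)
  moreover have "c * cnj c = complex_of_real ((cmod c)\<^sup>2)" by (metis complex_norm_square)
  ultimately show ?thesis
    by (simp add: qform_def)
qed

lemma psd_cauchy_schwarz:
  assumes A: "psd_mat N A" and v: "v \<in> carrier_vec N" and w: "w \<in> carrier_vec N"
  shows "(cmod ((A *\<^sub>v v) \<bullet>c w))\<^sup>2 \<le> qform A v * qform A w"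
proof -
  let ?h = "(A *\<^sub>v v) \<bullet>c w"
  have H: "hermitian_mat N A" and pos: "\<And>v. v \<in> carrier_vec N \<Longrightarrow> 0 \<le> qform A v"
    using A by (auto simp: psd_mat_qform)
  have Reh: "Re (cnj ?h * ?h) = (cmod ?h)\<^sup>2"
    by (metis complex_norm_square Re_complex_of_real mult.commute)
  \<comment> \<open>With coefficient \<open>t * ?h\<close> for real \<open>t\<close>, the cross term
    is \<open>t\<close> times the squared modulus of \<open>?h\<close>, which leaves a real
    polynomial in \<open>t\<close> of degree at most two.\<close>
  have ineq: "0 \<le> qform A v - 2 * t * (cmod ?h)\<^sup>2 + t\<^sup>2 * (cmod ?h)\<^sup>2 * qform A w" for t :: real
  proof -
    have "0 \<le> qform A (v - (of_real t * ?h) \<cdot>\<^sub>v w)" using v w by (intro pos) auto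
    also have "\<dots> = qform A v - 2 * t * Re (cnj ?h * ?h) + t\<^sup>2 * (cmod ?h)\<^sup>2 * qform A w"
      unfolding qform_diff[OF H v w] by (simp add: norm_mult power_mult_distrib algebra_simps)
    finally show ?thesis unfolding Reh .
  qed
  show ?thesis
  proof (cases "qform A w = 0")
    case True
    show ?thesis
    proof (cases "?h = 0")
      case False
      then have "(cmod ?h)\<^sup>2 > 0" by simp
      \<comment> \<open>Here the polynomial is affine with negative slope, and at this
        \<open>t\<close> it takes the value -1.\<close>
      then show ?thesis using ineq[of "(qform A v + 1) / (2 * (cmod ?h)\<^sup>2)"] True by simp
    qed (simp add: True)
  next
    case False
    then have "qform A w > 0" using pos[OF w] by simp
    \<comment> \<open>This \<open>t\<close> minimises the polynomial.\<close>
    then show ?thesis using ineq[of "1 / qform A w"] 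
      by (simp add: field_simps power2_eq_square)
  qed
qed

lemma adjoint_adjoint [simp]: "mat_adjoint (mat_adjoint A) = (A :: complex mat)"
  by (intro eq_matI) auto

lemma hermitian_cnj:
  assumes "hermitian_mat N A" "i < N" "j < N"
  shows "cnj (A $$ (i,j)) = A $$ (j,i)"
proof -
  have "A $$ (j,i) = cnj (A $$ (i,j))" using assms unfolding hermitian_mat_iff by blast
  then show ?thesis by simp
qed

section \<open>Rank one matrices and the positive semidefinite cone\<close>

lemma qform_outer_mat:
  assumes x: "x \<in> carrier_vec N" and v: "v \<in> carrier_vec N"
  shows "qform (outer x) v = (cmod (x \<bullet>c v))\<^sup>2"
proof -
  have e: "x \<bullet>c v = (\<Sum>i<N. x $ i * cnj (v $ i))"
    using x v by (auto simp: scalar_prod_def atLeast0LessThan)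
  have "(outer x *\<^sub>v v) \<bullet>c v = (\<Sum>i<N. \<Sum>j<N. (x $ i * cnj (v $ i)) * cnj (x $ j * cnj (v $ j)))"
    unfolding sesq_sum[OF outer_carrier[OF x] v v]
    using x by (intro sum.cong refl) (auto simp: outer_def)
  also have "\<dots> = (x \<bullet>c v) * cnj (x \<bullet>c v)"
    unfolding e cnj_sum sum_product ..
  also have "\<dots> = complex_of_real ((cmod (x \<bullet>c v))\<^sup>2)"
    by (metis complex_norm_square)
  finally show ?thesis by (simp add: qform_def)
qed

lemma hermitian_outer: "x \<in> carrier_vec N \<Longrightarrow> hermitian_mat N (outer x)"
  unfolding hermitian_mat_iff by (auto simp: outer_def)

lemma psd_outer: "x \<in> carrier_vec N \<Longrightarrow> psd_mat N (outer x)"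
  by (simp add: psd_mat_qform hermitian_outer qform_outer_mat)

lemma qform_minus:
  assumes "A \<in> carrier_mat N N" "B \<in> carrier_mat N N" "v \<in> carrier_vec N"
  shows "qform (A - B) v = qform A v - qform B v"
proof -
  have "A - B \<in> carrier_mat N N" using assms by (simp add: minus_carrier_mat)
  then show ?thesis using assms by (simp add: qform_sum left_diff_distrib sum_subtractf)
qed

lemma qform_smult:
  assumes "A \<in> carrier_mat N N" "v \<in> carrier_vec N"
  shows "qform (complex_of_real c \<cdot>\<^sub>m A) v = c * qform A v"
proof -
  have "(\<Sum>i<N. \<Sum>j<N. (complex_of_real c \<cdot>\<^sub>m A) $$ (i,j) * v $ j * cnj (v $ i))
    = complex_of_real c * (\<Sum>i<N. \<Sum>j<N. A $$ (i,j) * v $ j * cnj (v $ i))"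
    using assms by (simp add: sum_distrib_left mult.assoc)
  moreover have "complex_of_real c \<cdot>\<^sub>m A \<in> carrier_mat N N" using assms by simp
  ultimately have "qform (complex_of_real c \<cdot>\<^sub>m A) v
      = Re (complex_of_real c * (\<Sum>i<N. \<Sum>j<N. A $$ (i,j) * v $ j * cnj (v $ i)))"
    using assms by (simp only: qform_sum)
  then show ?thesis unfolding qform_sum[OF assms] times_complex.sel by simp
qed

lemma hermitian_minus:
  assumes "hermitian_mat N A" "hermitian_mat N B"
  shows "hermitian_mat N (A - B)"
  unfolding hermitian_mat_iff[of N "A - B"]
  using hermitian_carrier[OF assms(1)] hermitian_carrier[OF assms(2)]
  by (auto simp: minus_carrier_mat hermitian_cnj[OF assms(1)] hermitian_cnj[OF assms(2)])

lemma hermitian_smult: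
  assumes "hermitian_mat N A"
  shows "hermitian_mat N (complex_of_real c \<cdot>\<^sub>m A)"
  unfolding hermitian_mat_iff[of N "_ \<cdot>\<^sub>m A"]
  using hermitian_carrier[OF assms] by (auto simp: hermitian_cnj[OF assms])

lemma qform_add:
  assumes "A \<in> carrier_mat N N" "B \<in> carrier_mat N N" "v \<in> carrier_vec N"
  shows "qform (A + B) v = qform A v + qform B v"
proof -
  have c: "A + B \<in> carrier_mat N N" using assms by simp
  have "(\<Sum>i<N. \<Sum>j<N. (A + B) $$ (i,j) * v $ j * cnj (v $ i))
      = (\<Sum>i<N. \<Sum>j<N. A $$ (i,j) * v $ j * cnj (v $ i) + B $$ (i,j) * v $ j * cnj (v $ i))"
    using assms by (intro sum.cong refl) (simp add: distrib_right)
  then show ?thesis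
    unfolding qform_sum[OF c assms(3)] qform_sum[OF assms(1,3)] qform_sum[OF assms(2,3)]
    by (simp only: sum.distrib plus_complex.sel)
qed

lemma psd_add:
  assumes "psd_mat N A" "psd_mat N B"
  shows "psd_mat N (A + B)"
proof -
  have c: "A \<in> carrier_mat N N" "B \<in> carrier_mat N N" and H: "hermitian_mat N A" "hermitian_mat N B"
    using assms by (auto simp: psd_carrier psd_mat_def)
  have "hermitian_mat N (A + B)"
    unfolding hermitian_mat_iff[of N "A + B"]
    using c by (auto simp: hermitian_cnj[OF H(1)] hermitian_cnj[OF H(2)])
  then show ?thesis using assms by (simp add: psd_mat_qform qform_add[OF c])
qed

lemma psd_smult:
  assumes "psd_mat N A" "0 \<le> c"
  shows "psd_mat N (complex_of_real c \<cdot>\<^sub>m A)"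
  using assms by (simp add: psd_mat_qform qform_smult[OF psd_carrier[OF assms(1)]] hermitian_smult)

lemma psd_zero: "psd_mat N (0\<^sub>m N N)"
proof -
  have "qform (0\<^sub>m N N) v = 0" if "v \<in> carrier_vec N" for v
    using qform_sum[OF zero_carrier_mat that] by simp
  then show ?thesis by (simp add: psd_mat_qform hermitian_mat_iff)
qed

section \<open>Trace positivity\<close>

lemma unit_vec_sesq:
  fixes A :: "complex mat"
  assumes "A \<in> carrier_mat N N" "i < N" "j < N"
  shows "(A *\<^sub>v unit_vec N j) \<bullet>c unit_vec N i = A $$ (i,j)"
proof -
  have u: "(unit_vec N l :: complex vec) \<in> carrier_vec N" for l by simp
  have "(A *\<^sub>v unit_vec N j) \<bullet>c unit_vec N i
    = (\<Sum>i'<N. \<Sum>j'<N. if j' = j then (if i' = i then A $$ (i',j') else 0) else 0)"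
    using assms unfolding sesq_sum[OF assms(1) u[of j] u[of i]] by (intro sum.cong refl) (auto simp: unit_vec_def)
  then show ?thesis using assms by simp
qed

lemma unit_vec_qform:
  assumes "A \<in> carrier_mat N N" "i < N"
  shows "qform A (unit_vec N i) = Re (A $$ (i,i))"
  using unit_vec_sesq[OF assms(1,2,2)] by (simp add: qform_def)

lemma psd_diag_nonneg:
  assumes "psd_mat N A" "i < N"
  shows "0 \<le> Re (A $$ (i,i))"
proof -
  have "0 \<le> qform A (unit_vec N i)" using assms(1) by (simp add: psd_mat_qform)
  then show ?thesis by (simp add: unit_vec_qform[OF psd_carrier[OF assms(1)] assms(2)])
qed

lemma psd_tr_nonneg: "psd_mat N A \<Longrightarrow> 0 \<le> Re (mat_tr A)"
  using psd_carrier[of N A] by (auto simp: mat_tr_def intro!: sum_nonneg psd_diag_nonneg)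

lemma psd_diag_le_tr:
  assumes "psd_mat N A" "i < N"
  shows "Re (A $$ (i,i)) \<le> Re (mat_tr A)"
  using psd_carrier[OF assms(1)] assms
  by (auto simp: mat_tr_def intro!: member_le_sum psd_diag_nonneg)

text \<open>Cauchy-Schwarz at two unit vectors bounds an entry by two diagonal entries, each at most
  the trace. So positive semidefinite matrices of bounded trace form a bounded set, and trace zero
  forces the zero matrix.\<close>

lemma psd_entry_bound:
  assumes A: "psd_mat N A" and i: "i < N" and j: "j < N"
  shows "cmod (A $$ (i,j)) \<le> Re (mat_tr A)"
proof -
  have "(cmod (A $$ (i,j)))\<^sup>2 \<le> Re (A $$ (j,j)) * Re (A $$ (i,i))"
    using psd_cauchy_schwarz[OF A unit_vec_carrier[of N j] unit_vec_carrier[of N i]]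
    by (simp add: unit_vec_sesq unit_vec_qform psd_carrier[OF A] i j)
  also have "\<dots> \<le> (Re (mat_tr A))\<^sup>2"
    unfolding power2_eq_square
    by (intro mult_mono psd_diag_le_tr[OF A] psd_diag_nonneg[OF A] psd_tr_nonneg[OF A] i j)
  finally show ?thesis using psd_tr_nonneg[OF A] by (rule power2_le_imp_le)
qed

lemma mat_tr_hermitian_real:
  assumes "hermitian_mat N A"
  shows "mat_tr A = complex_of_real (Re (mat_tr A))"
proof -
  have "A $$ (i,i) \<in> \<real>" if "i < N" for i
    using hermitian_cnj[OF assms that that] by (simp add: Reals_cnj_iff)
  then have "mat_tr A \<in> \<real>" using hermitian_carrier[OF assms] by (auto simp: mat_tr_def)
  then show ?thesis by (simp add: of_real_Re)
qed

lemma psd_tr_zero: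
  assumes "psd_mat N A" "Re (mat_tr A) = 0"
  shows "A = 0\<^sub>m N N"
  using psd_entry_bound[OF assms(1)] assms(2) psd_carrier[OF assms(1)] by (intro eq_matI) auto

text \<open>Cholesky elimination: while the rows of \<open>A\<close> of index at least \<open>r\<close> vanish, subtracting a rank one
  piece proportional to \<open>outer (col A r)\<close> clears row \<open>r\<close> as well and keeps \<open>A\<close> positive semidefinite.\<close>

lemma tr_psd_pd_aux:
  assumes Y: "pd_mat N Y" and A: "psd_mat N A"
    and supp: "\<And>i j. i < N \<Longrightarrow> j < N \<Longrightarrow> r \<le> i \<Longrightarrow> A $$ (i,j) = 0"
  shows "A = 0\<^sub>m N N \<or> 0 < Re (mat_tr (Y * A))"
  using A supp
proof (induction r arbitrary: A)
  case 0
  then show ?case using psd_carrier[OF 0(1)] by (auto intro!: eq_matI)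
next
  case (Suc r)
  have cA: "A \<in> carrier_mat N N" and cY: "Y \<in> carrier_mat N N" and H: "hermitian_mat N A"
    using Suc.prems(1) Y by (auto simp: psd_carrier pd_carrier psd_mat_def)
  show ?case
  proof (cases "r < N")
    case False
    then show ?thesis using Suc.IH[OF Suc.prems(1)] by auto
  next
    case r: True
    define a where "a = Re (A $$ (r,r))"
    have Arr: "A $$ (r,r) = complex_of_real a"
      using hermitian_cnj[OF H r r] unfolding a_def
      by (metis Reals_cnj_iff of_real_Re)
    have cs: "(cmod ((A *\<^sub>v unit_vec N r) \<bullet>c v))\<^sup>2 \<le> a * qform A v" if "v \<in> carrier_vec N" for v
      using psd_cauchy_schwarz[OF Suc.prems(1) unit_vec_carrier that, of r]
      by (simp add: unit_vec_qform[OF cA r] a_def)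
    show ?thesis
    proof (cases "a = 0")
      case True
      \<comment> \<open>A zero pivot: Cauchy-Schwarz makes column \<open>r\<close> vanish and
        Hermitian symmetry carries this over to row \<open>r\<close>, so nothing needs to be
        subtracted.\<close>
      have "A $$ (i,r) = 0" if "i < N" for i
        using cs[OF unit_vec_carrier[of N i]] True by (simp add: unit_vec_sesq[OF cA that r])
      then have "A $$ (r,j) = 0" if "j < N" for j
        using hermitian_cnj[OF H that r] that by simp
      then have "A $$ (i,j) = 0" if "i < N" "j < N" "r \<le> i" for i j
        using that Suc.prems(2)[of i j] by (cases "i = r") auto
      then show ?thesis using Suc.IH[OF Suc.prems(1)] by blast
    next
      case False
      then have a: "a > 0" using psd_diag_nonneg[OF Suc.prems(1) r] by (simp add: a_def)
      define x where "x = A *\<^sub>v unit_vec N r"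
      have x: "x \<in> carrier_vec N" using cA by (simp add: x_def)
      have xi: "x $ i = A $$ (i,r)" if "i < N" for i
        using that cA r by (simp add: x_def)
      \<comment> \<open>The Schur complement of the pivot: column \<open>r\<close> of
        \<open>outer x\<close> is \<open>a\<close> times column \<open>r\<close> of
        \<open>A\<close>.\<close>
      define A' where "A' = A - complex_of_real (1/a) \<cdot>\<^sub>m outer x"
      have cO: "complex_of_real (1/a) \<cdot>\<^sub>m outer x \<in> carrier_mat N N" using x by simp
      have cA': "A' \<in> carrier_mat N N" using x by (simp add: A'_def minus_carrier_mat)
      have psd: "psd_mat N A'"
        unfolding psd_mat_qform
      proof (intro conjI ballI)
        show "hermitian_mat N A'" unfolding A'_def
          by (intro hermitian_minus H hermitian_smult hermitian_outer x)
        fix v :: "complex vec" assume v: "v \<in> carrier_vec N"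
        have "qform A' v = qform A v - (1/a) * (cmod (x \<bullet>c v))\<^sup>2"
          unfolding A'_def qform_minus[OF cA cO v] qform_smult[OF outer_carrier[OF x] v] qform_outer_mat[OF x v] ..
        \<comment> \<open>Cauchy-Schwarz divided by the pivot is exactly the semidefiniteness of the
          difference.\<close>
        moreover have "(1/a) * (cmod (x \<bullet>c v))\<^sup>2 \<le> qform A v"
          using cs[OF v] a by (simp add: x_def pos_divide_le_eq mult.commute)
        ultimately show "0 \<le> qform A' v" by simp
      qed
      have "A' $$ (i,j) = 0" if "i < N" "j < N" "r \<le> i" for i j
      proof -
        have e: "A' $$ (i,j) = A $$ (i,j) - complex_of_real (1/a) * (A $$ (i,r) * A $$ (r,j))"
          using that x cA xi[OF that(1)] xi[OF that(2)] hermitian_cnj[OF H that(2) r] by (simp add: A'_def outer_def)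
        show ?thesis
        proof (cases "i = r")
          case True
          then show ?thesis using e Arr a by simp
        next
          case False
          then have "Suc r \<le> i" using that by simp
          then show ?thesis using e Suc.prems(2)[OF that(1)] that r by simp
        qed
      qed
      then have IH: "A' = 0\<^sub>m N N \<or> 0 < Re (mat_tr (Y * A'))"
        using Suc.IH[OF psd] by blast
      have "x $ r \<noteq> 0" using xi[OF r] Arr a by simp
      then have "x \<noteq> 0\<^sub>v N" using r by auto
      then have q: "0 < qform Y x" using Y x by (simp add: pd_mat_def)
      \<comment> \<open>Restoring the rank one piece raises the trace against \<open>Y\<close> by
        \<open>qform Y x / a\<close>, which is positive because \<open>x\<close> is nonzero.\<close>
      have "A = A' + complex_of_real (1/a) \<cdot>\<^sub>m outer x"
        using cA carrier_matD[OF outer_carrier[OF x]] by (intro eq_matI) (auto simp: A'_def)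
      then have "Y * A = Y * A' + complex_of_real (1/a) \<cdot>\<^sub>m (Y * outer x)"
        using mult_add_distrib_mat[OF cY cA' cO] mult_smult_distrib[OF cY outer_carrier[OF x]] by simp
      then have "mat_tr (Y * A) = mat_tr (Y * A') + complex_of_real (1/a) * mat_tr (Y * outer x)"
        using mat_tr_add[OF mult_carrier_mat[OF cY cA'] smult_carrier_mat[OF mult_carrier_mat[OF cY outer_carrier[OF x]]]]
          mat_tr_smult[OF mult_carrier_mat[OF cY outer_carrier[OF x]]] by simp
      then have "Re (mat_tr (Y * A)) = Re (mat_tr (Y * A')) + qform Y x / a"
        using qform_outer[OF cY x] by simp
      moreover have "0 \<le> Re (mat_tr (Y * A'))"
        using IH cY by (auto simp: mat_tr_def)
      ultimately show ?thesis using q a by (simp add: add_nonneg_pos)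
    qed
  qed
qed

text \<open>Elimination starts at \<open>r = N\<close>, where the condition on vanishing rows is
  vacuous.\<close>

lemma tr_pd_psd_pos:
  assumes "pd_mat N Y" "psd_mat N A" "A \<noteq> 0\<^sub>m N N"
  shows "0 < Re (mat_tr (Y * A))"
  using tr_psd_pd_aux[OF assms(1,2), of N] assms(3) by auto

lemma tr_pd_psd_nonneg:
  assumes "pd_mat N Y" "psd_mat N A"
  shows "0 \<le> Re (mat_tr (Y * A))"
  using tr_psd_pd_aux[OF assms(1,2), of N] pd_carrier[OF assms(1)] by (auto simp: mat_tr_def)

section \<open>Congruences and inverses of positive definite matrices\<close>

lemma hermitian_congruence:
  assumes A: "hermitian_mat N A" and B: "B \<in> carrier_mat N d"
  shows "hermitian_mat d (mat_adjoint B * A * B)"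
proof -
  have cA: "A \<in> carrier_mat N N" using A by (rule hermitian_carrier)
  have cB: "mat_adjoint B \<in> carrier_mat d N" using B by simp
  have "mat_adjoint (mat_adjoint B * A * B) = mat_adjoint B * (mat_adjoint A * B)"
    using adjoint_mult[OF mult_carrier_mat[OF cB cA] B] adjoint_mult[OF cB cA] by simp
  also have "\<dots> = mat_adjoint B * A * B"
    using A assoc_mult_mat[OF cB cA B] by (simp add: hermitian_mat_def)
  finally show ?thesis using mult_carrier_mat[OF mult_carrier_mat[OF cB cA] B] by (simp add: hermitian_mat_def)
qed

lemma qform_congruence:
  assumes A: "A \<in> carrier_mat N N" and B: "B \<in> carrier_mat N d" and w: "w \<in> carrier_vec d"
  shows "qform (mat_adjoint B * A * B) w = qform A (B *\<^sub>v w)"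
proof -
  have cB: "mat_adjoint B \<in> carrier_mat d N" using B by simp
  have "(mat_adjoint B * A * B) *\<^sub>v w = mat_adjoint B *\<^sub>v (A *\<^sub>v (B *\<^sub>v w))"
    using assoc_mult_mat_vec[OF mult_carrier_mat[OF cB A] B w]
      assoc_mult_mat_vec[OF cB A mult_mat_vec_carrier[OF B w]] by simp
  then show ?thesis
    using adjoint_sesq[OF cB, of "A *\<^sub>v (B *\<^sub>v w)" w] A B w by (simp add: qform_def)
qed

lemma psd_congruence:
  assumes A: "psd_mat N A" and B: "B \<in> carrier_mat N d"
  shows "psd_mat d (mat_adjoint B * A * B)"
  using A B unfolding psd_mat_qform
  by (simp add: qform_congruence[OF psd_carrier[OF A] B] hermitian_congruence[OF _ B])

lemma psd_congruence':
  assumes A: "psd_mat d A" and B: "B \<in> carrier_mat N d"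
  shows "psd_mat N (B * A * mat_adjoint B)"
  using psd_congruence[OF A adjoint_carrier[OF B]] by simp

lemma pd_congruence:
  assumes A: "pd_mat N A" and B: "B \<in> carrier_mat N d"
    and inj: "\<And>w. w \<in> carrier_vec d \<Longrightarrow> B *\<^sub>v w = 0\<^sub>v N \<Longrightarrow> w = 0\<^sub>v d"
  shows "pd_mat d (mat_adjoint B * A * B)"
  unfolding pd_mat_def
proof (intro conjI ballI impI)
  show "hermitian_mat d (mat_adjoint B * A * B)"
    using A by (intro hermitian_congruence[OF _ B]) (simp add: pd_mat_def)
  fix w :: "complex vec" assume w: "w \<in> carrier_vec d" "w \<noteq> 0\<^sub>v d"
  then have "B *\<^sub>v w \<noteq> 0\<^sub>v N" "B *\<^sub>v w \<in> carrier_vec N" using inj B by auto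
  then have "0 < qform A (B *\<^sub>v w)" using A by (simp add: pd_mat_def)
  then show "0 < qform (mat_adjoint B * A * B) w"
    by (simp add: qform_congruence[OF pd_carrier[OF A] B w(1)])
qed

lemma pd_inverse:
  assumes C: "pd_mat N C"
  obtains V where "pd_mat N V" "C * V = 1\<^sub>m N" "V * C = 1\<^sub>m N"
proof -
  have cC: "C \<in> carrier_mat N N" and H: "hermitian_mat N C" using C by (auto simp: pd_carrier pd_mat_def)
  \<comment> \<open>A nonzero kernel vector would have form value zero.\<close>
  have "det C \<noteq> 0"
  proof
    assume "det C = 0"
    then obtain v where v: "v \<in> carrier_vec N" "v \<noteq> 0\<^sub>v N" "C *\<^sub>v v = 0\<^sub>v N"
      using det_0_iff_vec_prod_zero[OF cC] by blast
    then have "0 < qform C v" using C by (simp add: pd_mat_def)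
    then show False using v by (simp add: qform_def)
  qed
  then obtain V where V: "V \<in> carrier_mat N N" "C * V = 1\<^sub>m N" "V * C = 1\<^sub>m N"
    using det_non_zero_imp_unit[OF cC, of "()"] unfolding Units_def by (auto simp: ring_mat_def)
  have cV': "mat_adjoint V \<in> carrier_mat N N" using V by simp
  have one: "mat_adjoint (1\<^sub>m N) = (1\<^sub>m N :: complex mat)" by (intro eq_matI) auto
  \<comment> \<open>\<open>mat_adjoint V\<close> is a left inverse of \<open>C\<close> and
    \<open>V\<close> a right inverse, so they agree and \<open>V\<close> is Hermitian.\<close>
  have "mat_adjoint V * C = 1\<^sub>m N"
    using adjoint_mult[OF cC V(1)] V(2) H one by (simp add: hermitian_mat_def)
  then have "mat_adjoint V = V"
    using assoc_mult_mat[OF cV' cC V(1)] left_mult_one_mat[OF V(1)] right_mult_one_mat[OF cV'] V(2)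
    by simp
  then have HV: "hermitian_mat N V" using V by (simp add: hermitian_mat_def)
  have "0 < qform V v" if v: "v \<in> carrier_vec N" "v \<noteq> 0\<^sub>v N" for v
  proof -
    \<comment> \<open>The form of \<open>V\<close> at \<open>v\<close> is the form of
      \<open>C\<close> at \<open>w\<close>.\<close>
    define w where "w = V *\<^sub>v v"
    have w: "w \<in> carrier_vec N" using V v by (simp add: w_def)
    have vw: "v = C *\<^sub>v w" using assoc_mult_mat_vec[OF cC V(1) v(1)] V(2) v(1) by (simp add: w_def)
    have "w \<noteq> 0\<^sub>v N" using vw v cC by auto
    then have "0 < qform C w" using C w by (simp add: pd_mat_def)
    also have "qform C w = Re ((C *\<^sub>v w) \<bullet>c w)" by (simp add: qform_def)
    also have "\<dots> = Re ((V *\<^sub>v v) \<bullet>c v)"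
      using hermitian_sesq[OF HV v(1) v(1)] adjoint_sesq[OF V(1) v(1) v(1)] HV
      by (simp add: vw[symmetric] w_def[symmetric] hermitian_mat_def)
    finally show ?thesis by (simp add: qform_def)
  qed
  then have "pd_mat N V" using HV by (simp add: pd_mat_def)
  then show thesis using V that by blast
qed

section \<open>Partial traces and ampliations\<close>

text \<open>The trace over the second tensor factor, in the encoding where \<open>i * n + a\<close>
  indexes e_i tensor e_a.\<close>

definition ptrace :: "nat \<Rightarrow> nat \<Rightarrow> complex mat \<Rightarrow> complex mat" where
  "ptrace m n X = mat m m (\<lambda>(i,j). \<Sum>a<n. X $$ (i * n + a, j * n + a))"

definition ampl :: "nat \<Rightarrow> complex mat \<Rightarrow> complex mat" where
  "ampl n T = kronecker T (1\<^sub>m n)"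

lemma ptrace_carrier [simp]: "ptrace m n X \<in> carrier_mat m m"
  by (simp add: ptrace_def)

lemma ampl_carrier [simp]: "T \<in> carrier_mat m m \<Longrightarrow> ampl n T \<in> carrier_mat (m * n) (m * n)"
  by (auto simp: ampl_def kronecker_def)

lemma ptrace_index:
  assumes "i < m" "j < m"
  shows "ptrace m n X $$ (i,j) = (\<Sum>a<n. X $$ (i * n + a, j * n + a))"
  using assms by (simp add: ptrace_def)

lemma sum_block_index:
  fixes f :: "nat \<Rightarrow> 'a :: comm_monoid_add"
  shows "(\<Sum>s<m*n. f s) = (\<Sum>i<m. \<Sum>a<n. f (i * n + a))"
proof -
  have "sum f {i * n ..< i * n + n} = (\<Sum>a<n. f (i * n + a))" for i
    by (rule sum.reindex_bij_witness[where i = "\<lambda>a. i * n + a" and j = "\<lambda>s. s - i * n"]) auto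
  then show ?thesis using sum.nat_group[of f n m] by simp
qed

lemma ampl_index:
  assumes "T \<in> carrier_mat m m" "r < m * n" "s < m * n"
  shows "ampl n T $$ (r, s) = (if r mod n = s mod n then T $$ (r div n, s div n) else 0)"
  using assms block_index_less[OF assms(2)] block_index_less[OF assms(3)]
  by (auto simp: ampl_def kronecker_def)

lemma ampl_block_index:
  assumes "T \<in> carrier_mat m m" "i < m" "j < m" "a < n" "b < n"
  shows "ampl n T $$ (i * n + a, j * n + b) = (if a = b then T $$ (i, j) else 0)"
  using assms by (simp add: ampl_index[OF assms(1)] mat_index_less)

text \<open>Ampliation is adjoint to the partial trace under the trace pairing: inside each block
  only the diagonal terms \<open>b = a\<close> survive.\<close>

lemma tr_mult_ampl:
  assumes Y: "Y \<in> carrier_mat (m * n) (m * n)" and T: "T \<in> carrier_mat m m"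
  shows "mat_tr (Y * ampl n T) = mat_tr (ptrace m n Y * T)"
proof -
  have "mat_tr (Y * ampl n T) = (\<Sum>i<m. \<Sum>a<n. \<Sum>j<m. \<Sum>b<n. Y $$ (i*n+a, j*n+b) * ampl n T $$ (j*n+b, i*n+a))"
    unfolding mat_tr_mult[OF Y ampl_carrier[OF T]] sum_block_index ..
  also have "\<dots> = (\<Sum>i<m. \<Sum>a<n. \<Sum>j<m. \<Sum>b<n. if b = a then Y $$ (i*n+a, j*n+b) * T $$ (j, i) else 0)"
    by (intro sum.cong refl) (simp add: ampl_block_index[OF T])
  also have "\<dots> = (\<Sum>i<m. \<Sum>a<n. \<Sum>j<m. Y $$ (i*n+a, j*n+a) * T $$ (j, i))"
    by (intro sum.cong refl) simp
  also have "\<dots> = (\<Sum>i<m. \<Sum>j<m. \<Sum>a<n. Y $$ (i*n+a, j*n+a) * T $$ (j, i))"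
    by (intro sum.cong refl sum.swap)
  also have "\<dots> = mat_tr (ptrace m n Y * T)"
    unfolding mat_tr_mult[OF ptrace_carrier T]
    by (intro sum.cong refl) (simp add: ptrace_def sum_distrib_right)
  finally show ?thesis .
qed

text \<open>The trace of block \<open>(i, j)\<close> is entry \<open>(i, j)\<close> of the partial
  trace, and the identity matrix inside \<open>R_map\<close> becomes the second tensor
  factor.\<close>

lemma id_tensor_R_map:
  assumes X: "X \<in> carrier_mat (m * n) (m * n)"
  shows "id_tensor m n (R_map k n) X = of_nat k \<cdot>\<^sub>m ampl n (ptrace m n X) - X"
proof (rule eq_matI)
  fix r c assume "r < dim_row (of_nat k \<cdot>\<^sub>m ampl n (ptrace m n X) - X)"
    "c < dim_col (of_nat k \<cdot>\<^sub>m ampl n (ptrace m n X) - X)"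
  then have rc: "r < m * n" "c < m * n" using X by auto
  note b = block_index_less[OF rc(1)] block_index_less[OF rc(2)]
  have tr: "mat_tr (mat_block n X i j) = (\<Sum>a<n. X $$ (i * n + a, j * n + a))" for i j
    by (simp add: mat_tr_def mat_block_def)
  have e: "r div n * n + c mod n = r" if "r mod n = c mod n"
    using that by (metis div_mult_mod_eq)
  show "id_tensor m n (R_map k n) X $$ (r, c) = (of_nat k \<cdot>\<^sub>m ampl n (ptrace m n X) - X) $$ (r, c)"
    using rc b X carrier_matD[OF ampl_carrier[OF ptrace_carrier, of n m n X]]
    by (simp add: id_tensor_def R_map_def tr ampl_index[OF ptrace_carrier] ptrace_index)
      (simp add: mat_block_def e)
qed (use X in \<open>auto simp: id_tensor_def\<close>)

lemma hermitian_ampl: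
  assumes T: "hermitian_mat m T"
  shows "hermitian_mat (m * n) (ampl n T)"
  unfolding hermitian_mat_iff
proof (intro conjI allI impI)
  show "ampl n T \<in> carrier_mat (m * n) (m * n)" using hermitian_carrier[OF T] by simp
  fix i j assume "i < m * n" "j < m * n"
  then show "ampl n T $$ (i, j) = cnj (ampl n T $$ (j, i))"
    using block_index_less[of i m n] block_index_less[of j m n]
    by (simp add: ampl_index[OF hermitian_carrier[OF T]] hermitian_cnj[OF T])
qed

lemma hermitian_ptrace:
  assumes X: "hermitian_mat (m * n) X"
  shows "hermitian_mat m (ptrace m n X)"
  unfolding hermitian_mat_iff
  by (auto simp: ptrace_def mat_index_less hermitian_cnj[OF X])

text \<open>For each fixed second index \<open>a\<close>, the slice of \<open>z\<close> is acted on
  by \<open>T\<close> alone, so the ampliation is a direct sum of \<open>n\<close> copies of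
  \<open>T\<close>. It inherits semidefiniteness and definiteness from \<open>T\<close>.\<close>

lemma qform_ampl:
  assumes T: "T \<in> carrier_mat m m" and z: "z \<in> carrier_vec (m * n)"
  shows "qform (ampl n T) z = (\<Sum>a<n. qform T (vec m (\<lambda>i. z $ (i * n + a))))"
proof -
  let ?f = "\<lambda>i a j. T $$ (i,j) * z $ (j*n+a) * cnj (z $ (i*n+a))"
  have "(\<Sum>r<m*n. \<Sum>s<m*n. ampl n T $$ (r,s) * z $ s * cnj (z $ r))
    = (\<Sum>i<m. \<Sum>a<n. \<Sum>j<m. \<Sum>b<n. ampl n T $$ (i*n+a,j*n+b) * z $ (j*n+b) * cnj (z $ (i*n+a)))"
    unfolding sum_block_index ..
  also have "\<dots> = (\<Sum>i<m. \<Sum>a<n. \<Sum>j<m. \<Sum>b<n. if b = a then ?f i a j else 0)"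
    by (intro sum.cong refl) (simp add: ampl_block_index[OF T])
  also have "\<dots> = (\<Sum>i<m. \<Sum>a<n. \<Sum>j<m. ?f i a j)" by simp
  also have "\<dots> = (\<Sum>a<n. \<Sum>i<m. \<Sum>j<m. ?f i a j)" by (rule sum.swap)
  finally have "qform (ampl n T) z = (\<Sum>a<n. Re (\<Sum>i<m. \<Sum>j<m. ?f i a j))"
    unfolding qform_sum[OF ampl_carrier[OF T] z] by (simp only: Re_sum)
  then show ?thesis
    by (simp add: qform_sum[OF T])
qed

lemma psd_ampl:
  assumes T: "psd_mat m T"
  shows "psd_mat (m * n) (ampl n T)"
  using T unfolding psd_mat_qform
  by (auto simp: hermitian_ampl qform_ampl[OF psd_carrier[OF T]] intro!: sum_nonneg)

lemma pd_ampl: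
  assumes T: "pd_mat m T"
  shows "pd_mat (m * n) (ampl n T)"
  unfolding pd_mat_def
proof (intro conjI ballI impI)
  show "hermitian_mat (m * n) (ampl n T)" using T by (simp add: pd_mat_def hermitian_ampl)
  fix z :: "complex vec" assume z: "z \<in> carrier_vec (m * n)" "z \<noteq> 0\<^sub>v (m * n)"
  let ?s = "\<lambda>a. vec m (\<lambda>i. z $ (i * n + a))"
  obtain r where r: "r < m * n" "z $ r \<noteq> 0" using z by (auto simp: vec_eq_iff)
  note b = block_index_less[OF r(1)]
  have "?s (r mod n) $ (r div n) \<noteq> 0" using b r by simp
  then have "?s (r mod n) \<noteq> 0\<^sub>v m" using b by (metis index_zero_vec(1))
  then have "0 < qform T (?s (r mod n))" using T by (simp add: pd_mat_def)
  moreover have "0 \<le> qform T (?s a)" for a using pd_imp_psd[OF T] by (simp add: psd_mat_qform)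
  ultimately have "0 < (\<Sum>a<n. qform T (?s a))" using b by (intro sum_pos2[of _ "r mod n"]) auto
  then show "0 < qform (ampl n T) z" using z by (simp add: qform_ampl[OF pd_carrier[OF T]])
qed

lemma ampl_mult:
  assumes T: "T \<in> carrier_mat m m" and V: "V \<in> carrier_mat m m"
  shows "ampl n T * ampl n V = ampl n (T * V)"
proof (rule eq_matI)
  have TV: "T * V \<in> carrier_mat m m" using T V by simp
  note cT = carrier_matD[OF ampl_carrier[OF T, of n]] carrier_matD[OF ampl_carrier[OF V, of n]]
    carrier_matD[OF ampl_carrier[OF TV, of n]]
  show "dim_row (ampl n T * ampl n V) = dim_row (ampl n (T * V))"
    "dim_col (ampl n T * ampl n V) = dim_col (ampl n (T * V))" using cT by simp_all
  fix r c assume "r < dim_row (ampl n (T * V))" "c < dim_col (ampl n (T * V))"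
  then have rc: "r < m * n" "c < m * n" using cT by auto
  note b = block_index_less[OF rc(1)] block_index_less[OF rc(2)]
  have "(ampl n T * ampl n V) $$ (r,c) = (\<Sum>s<m*n. ampl n T $$ (r,s) * ampl n V $$ (s,c))"
    using rc cT by (simp add: scalar_prod_def atLeast0LessThan)
  also have "\<dots> = (\<Sum>j<m. \<Sum>a<n. ampl n T $$ (r,j*n+a) * ampl n V $$ (j*n+a,c))"
    by (rule sum_block_index)
  also have "\<dots> = (\<Sum>j<m. \<Sum>a<n. if a = r mod n then
      (if r mod n = c mod n then T $$ (r div n, j) * V $$ (j, c div n) else 0) else 0)"
    using rc by (intro sum.cong refl) (auto simp: ampl_index[OF T] ampl_index[OF V] mat_index_less)
  also have "\<dots> = (if r mod n = c mod n then (\<Sum>j<m. T $$ (r div n, j) * V $$ (j, c div n)) else 0)"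
    using b by simp
  also have "\<dots> = ampl n (T * V) $$ (r,c)"
    using T V b rc by (simp add: ampl_index[OF TV] scalar_prod_def atLeast0LessThan)
  finally show "(ampl n T * ampl n V) $$ (r,c) = ampl n (T * V) $$ (r,c)" .
qed

lemma ampl_one: "ampl n (1\<^sub>m m) = 1\<^sub>m (m * n)"
proof (rule eq_matI)
  fix r c assume "r < dim_row (1\<^sub>m (m * n) :: complex mat)" "c < dim_col (1\<^sub>m (m * n) :: complex mat)"
  then have rc: "r < m * n" "c < m * n" by auto
  have "r = c" if "r mod n = c mod n" "r div n = c div n"
    using that by (metis div_mult_mod_eq)
  then show "ampl n (1\<^sub>m m) $$ (r,c) = 1\<^sub>m (m * n) $$ (r,c)"
    using rc block_index_less[OF rc(1)] block_index_less[OF rc(2)] by (auto simp: ampl_index[of _ m])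
qed (auto simp: ampl_def kronecker_def)

text \<open>By adjointness the form of the partial trace at \<open>u\<close> is the pairing of
  \<open>Y\<close> with \<open>ampl n (outer u)\<close>, a nonzero positive semidefinite
  matrix.\<close>

lemma pd_ptrace:
  assumes Y: "pd_mat (m * n) Y" and n: "0 < n"
  shows "pd_mat m (ptrace m n Y)"
  unfolding pd_mat_def
proof (intro conjI ballI impI)
  show "hermitian_mat m (ptrace m n Y)" using Y by (simp add: pd_mat_def hermitian_ptrace)
  fix u :: "complex vec" assume u: "u \<in> carrier_vec m" "u \<noteq> 0\<^sub>v m"
  obtain i where i: "i < m" "u $ i \<noteq> 0" using u by (auto simp: vec_eq_iff)
  \<comment> \<open>\<open>0 < n\<close> makes the second index 0 available; the entry there is the
    squared modulus of \<open>u $ i\<close>.\<close>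
  have "ampl n (outer u) $$ (i * n + 0, i * n + 0) \<noteq> 0"
    using i n u by (subst ampl_block_index[of _ m]) (auto simp: outer_def)
  moreover have "i * n + 0 < m * n" using mat_index_less[OF i(1) n] .
  ultimately have "ampl n (outer u) \<noteq> 0\<^sub>m (m * n) (m * n)" by auto
  then have "0 < Re (mat_tr (Y * ampl n (outer u)))"
    using tr_pd_psd_pos[OF Y psd_ampl[OF psd_outer[OF u(1)]]] by blast
  then show "0 < qform (ptrace m n Y) u"
    using u by (simp add: tr_mult_ampl[OF pd_carrier[OF Y]] qform_outer[OF ptrace_carrier])
qed

lemma tr_ptrace:
  assumes "X \<in> carrier_mat (m * n) (m * n)"
  shows "mat_tr (ptrace m n X) = mat_tr X"
  using assms by (simp add: mat_tr_def sum_block_index ptrace_def)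

section \<open>Subspaces as ranges of injective matrices\<close>

lemma mat_range_eq_span:
  assumes B: "B \<in> carrier_mat N d"
  shows "mat_range B = LinearCombinations.module.span class_ring (module_vec TYPE(complex) N) (set (cols B))"
proof -
  interpret vec_space "TYPE(complex)" N .
  have "mat_range B = {y \<in> carrier_vec (dim_row B). \<exists>x\<in>carrier_vec (dim_col B). B *\<^sub>v x = y}"
    using B by (auto simp: mat_range_def)
  also have "\<dots> = col_space B" using col_space_eq[OF B] by simp
  finally show ?thesis by (simp add: col_space_def)
qed

lemma injective_imp_subspace_dim:
  assumes B: "B \<in> carrier_mat N d"
    and inj: "\<And>w. w \<in> carrier_vec d \<Longrightarrow> B *\<^sub>v w = 0\<^sub>v N \<Longrightarrow> w = 0\<^sub>v d"
  shows "is_subspace N (mat_range B)" "subspace_dim N (mat_range B) = d"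
proof -
  interpret vec_space "TYPE(complex)" N .
  have sub: "set (cols B) \<subseteq> carrier_vec N" using cols_dim[of B] B by auto
  have range: "mat_range B = span (set (cols B))"
    by (rule mat_range_eq_span[OF B])
  then show "is_subspace N (mat_range B)" using span_is_subspace[OF sub] by simp
  \<comment> \<open>Independence is stated for the set of columns, so repetitions are excluded
    first: two equal columns would put a difference of unit vectors into the kernel.\<close>
  have dist: "distinct (cols B)"
    unfolding distinct_conv_nth
  proof (intro allI impI notI)
    fix i j assume ij: "i < length (cols B)" "j < length (cols B)" "i \<noteq> j" "cols B ! i = cols B ! j"
    then have ijd: "i < d" "j < d" using B by auto
    have "B *\<^sub>v (unit_vec d i - unit_vec d j) = B *\<^sub>v unit_vec d i - B *\<^sub>v unit_vec d j"
      using B by (intro mult_minus_distrib_mat_vec) auto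
    also have "B *\<^sub>v unit_vec d i = col B i" using B ijd by auto
    also have "B *\<^sub>v unit_vec d j = col B j" using B ijd by auto
    also have "col B i - col B j = 0\<^sub>v N" using ij B by auto
    finally have "unit_vec d i - unit_vec d j = (0\<^sub>v d :: complex vec)" by (rule inj[rotated]) simp
    then have "(unit_vec d i - unit_vec d j) $ i = (0 :: complex)" using ijd by simp
    then show False using ijd ij by simp
  qed
  have "lin_indpt (set (cols B))"
  proof
    assume "lin_dep (set (cols B))"
    then show False using lin_depE[OF B _ dist] inj by metis
  qed
  then have "rank B = d" using lin_indpt_full_rank[OF B dist] by blast
  then show "subspace_dim N (mat_range B) = d" unfolding rank_def range by simp
qed

lemma subspace_basis_matrix:
  assumes S: "is_subspace N S"
  obtains B where "B \<in> carrier_mat N (subspace_dim N S)" "mat_range B = S"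
    "\<And>w. w \<in> carrier_vec (subspace_dim N S) \<Longrightarrow> B *\<^sub>v w = 0\<^sub>v N \<Longrightarrow> w = 0\<^sub>v (subspace_dim N S)"
proof -
  interpret vec_space "TYPE(complex)" N .
  interpret W: vectorspace class_ring "vs S" using subspace_is_vs[OF S] .
  have sub: "S \<subseteq> carrier_vec N" and subm: "submodule class_ring S V" using S
    by (auto simp: VectorSpace.subspace_def submodule_def)
  \<comment> \<open>Independence inside \<open>S\<close> agrees with independence in the ambient
    space, which bounds the size of independent sets by \<open>N\<close> and so provides a maximal
    one.\<close>
  have indep: "lin_indpt U" if "U \<subseteq> S" "W.lin_indpt U" for U
    using that span_li_not_depend(2)[OF that(1) subm] by blast
  have bound: "finite U \<and> card U \<le> N" if "U \<subseteq> S" "W.lin_indpt U" for U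
    using indep[OF that] li_le_dim[of U] that sub fin_dim dim_is_n by auto
  have "\<exists>U. finite U \<and> maximal U (\<lambda>U. U \<subseteq> carrier (vs S) \<and> W.lin_indpt U)"
    using bound
    by (intro maximal_exists[where N = N and B = "{}"]) (auto simp: W.lin_dep_def)
  then obtain U where U: "finite U" "maximal U (\<lambda>U. U \<subseteq> carrier (vs S) \<and> W.lin_indpt U)" by blast
  then have basis: "W.basis U" using W.max_li_is_basis by blast
  then have dimU: "W.dim = card U" using W.dim_basis U(1) by blast
  have US: "U \<subseteq> S" and liW: "W.lin_indpt U" and spanW: "W.span U = S"
    using basis unfolding W.basis_def by auto
  have span: "span U = S" using span_li_not_depend(1)[OF US subm] spanW by simp
  obtain us where us: "set us = U" "distinct us" using finite_distinct_list[OF U(1)] by blast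
  then have len: "length us = W.dim" using distinct_card[of us] dimU by simp
  define B where "B = mat_of_cols N us"
  have B: "B \<in> carrier_mat N W.dim" by (simp add: B_def len[symmetric])
  have cols: "cols B = us" using us US sub by (auto simp: B_def)
  have "mat_range B = S"
    unfolding mat_range_eq_span[OF B] cols us(1) by (rule span)
  moreover have "w = 0\<^sub>v W.dim" if "w \<in> carrier_vec W.dim" "B *\<^sub>v w = 0\<^sub>v N" for w
  proof (rule ccontr)
    assume "w \<noteq> 0\<^sub>v W.dim"
    then have "lin_dep U" using lin_depI[OF B that(1) _ that(2)] cols us by simp
    then show False using indep[OF US liW] by blast
  qed
  ultimately show thesis using that B by blast
qed

section \<open>Theorem of the alternative\<close>

text \<open>The variational inequality for the point nearest the origin: if it failed at some
  \<open>u\<close>, a short move from \<open>w\<close> towards \<open>u\<close> would lower the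
  norm. Compactness is asked of the parameter set \<open>C\<close>, convexity only of its image
  under \<open>F\<close>.\<close>

lemma min_norm_point:
  fixes C :: "'x :: topological_space set" and F :: "'x \<Rightarrow> 'i \<Rightarrow> complex"
  assumes C: "compact C" "C \<noteq> {}"
    and cont: "\<And>i. i \<in> I \<Longrightarrow> continuous_on C (\<lambda>x. F x i)"
    and conv: "\<And>x y t. x \<in> C \<Longrightarrow> y \<in> C \<Longrightarrow> 0 \<le> t \<Longrightarrow> t \<le> 1 \<Longrightarrow>
      \<exists>z\<in>C. \<forall>i\<in>I. F z i = of_real (1 - t) * F x i + of_real t * F y i"
  obtains w where "w \<in> C"
    "\<And>u. u \<in> C \<Longrightarrow> (\<Sum>i\<in>I. (cmod (F w i))\<^sup>2) \<le> Re (\<Sum>i\<in>I. cnj (F w i) * F u i)"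
proof -
  let ?n = "\<lambda>x. \<Sum>i\<in>I. (cmod (F x i))\<^sup>2"
  have "continuous_on C ?n" by (intro continuous_intros cont)
  then obtain w where w: "w \<in> C" and min: "\<And>u. u \<in> C \<Longrightarrow> ?n w \<le> ?n u"
    using continuous_attains_inf[OF C] by blast
  have "?n w \<le> Re (\<Sum>i\<in>I. cnj (F w i) * F u i)" if u: "u \<in> C" for u
  proof (rule ccontr)
    define D where "D = ?n w - Re (\<Sum>i\<in>I. cnj (F w i) * F u i)"
    define M where "M = (\<Sum>i\<in>I. (cmod (F u i - F w i))\<^sup>2)"
    assume "\<not> ?thesis"
    then have D: "D > 0" by (simp add: D_def)
    have M: "M \<ge> 0" by (simp add: M_def sum_nonneg)
    \<comment> \<open>The step length is chosen so that the quadratic term \<open>t * M\<close>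
      stays below the linear gain \<open>2 * D\<close>; the summand 1 avoids division by
      zero.\<close>
    define t where "t = min 1 (D / (M + 1))"
    have t: "0 < t" "t \<le> 1" using D M by (auto simp: t_def)
    obtain z where z: "z \<in> C" "\<And>i. i \<in> I \<Longrightarrow> F z i = of_real (1 - t) * F w i + of_real t * F u i"
      using conv[OF w u, of t] t by auto
    have sq: "(cmod (of_real (1 - t) * a + of_real t * b))\<^sup>2
        = (cmod a)\<^sup>2 - 2 * t * ((cmod a)\<^sup>2 - Re (cnj a * b)) + t\<^sup>2 * (cmod (b - a))\<^sup>2" for a b :: complex
      unfolding cmod_power2 by (simp add: power2_eq_square algebra_simps)
    have "?n z = (\<Sum>i\<in>I. (cmod (F w i))\<^sup>2 - 2 * t * ((cmod (F w i))\<^sup>2 - Re (cnj (F w i) * F u i))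
        + t\<^sup>2 * (cmod (F u i - F w i))\<^sup>2)"
      by (intro sum.cong refl) (simp only: z(2) sq)
    also have "\<dots> = ?n w - 2 * t * D + t\<^sup>2 * M"
      by (simp only: D_def M_def sum.distrib sum_subtractf sum_distrib_left Re_sum right_diff_distrib)
    finally have "t * (2 * D) \<le> t * (t * M)" using min[OF z(1)] by (simp add: power2_eq_square)
    then have "2 * D \<le> t * M" using t by simp
    also have "\<dots> \<le> D / (M + 1) * M" using M by (intro mult_right_mono) (auto simp: t_def)
    also have "\<dots> \<le> D" using D M by (simp add: field_simps)
    finally show False using D by simp
  qed
  then show thesis using that w by blast
qed

section \<open>Compactness of the positive semidefinite matrices of bounded trace\<close>

lemma compact_box_fun:
  "compact {f :: 'i \<Rightarrow> complex. \<forall>p. cmod (f p) \<le> 1}"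
proof -
  \<comment> \<open>The square around the unit disc is compact as an image of a product of
    intervals; Tychonoff makes the product of squares compact, and the discs cut out a closed
    subset.\<close>
  let ?B = "(\<lambda>(a,b). Complex a b) ` ({-1..1} \<times> {-1..1})"
  have "continuous_on ({-1..1} \<times> {-1..1}) (\<lambda>(a::real,b::real). of_real a + \<i> * of_real b)"
    unfolding case_prod_beta by (intro continuous_intros)
  then have "compact ?B"
    unfolding Complex_eq
    by (intro compact_continuous_image compact_Times compact_Icc) auto
  then have "compact (PiE UNIV (\<lambda>_::'i. ?B))"
    using compactin_PiE[of "\<lambda>_::'i. euclidean" UNIV "\<lambda>_. ?B"]
    by (simp add: euclidean_product_topology)
  moreover have "closed {f :: 'i \<Rightarrow> complex. \<forall>p. cmod (f p) \<le> 1}"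
    by (intro closed_Collect_all closed_Collect_le continuous_intros continuous_on_product_coordinates)
  ultimately have "compact (PiE UNIV (\<lambda>_::'i. ?B) \<inter> {f. \<forall>p. cmod (f p) \<le> 1})"
    by (rule compact_Int_closed)
  moreover have "{f :: 'i \<Rightarrow> complex. \<forall>p. cmod (f p) \<le> 1} \<subseteq> PiE UNIV (\<lambda>_. ?B)"
  proof (intro subsetI PiE_I)
    fix f :: "'i \<Rightarrow> complex" and p assume "f \<in> {f. \<forall>p. cmod (f p) \<le> 1}"
    then have "cmod (f p) \<le> 1" by simp
    then have "\<bar>Re (f p)\<bar> \<le> 1" "\<bar>Im (f p)\<bar> \<le> 1"
      using abs_Re_le_cmod[of "f p"] abs_Im_le_cmod[of "f p"] by linarith+
    then have "(Re (f p), Im (f p)) \<in> {-1..1} \<times> {-1..1}" by (simp add: abs_le_iff)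
    then show "f p \<in> ?B"
      unfolding image_iff by (intro bexI[where x = "(Re (f p), Im (f p))"]) simp_all
  qed auto
  ultimately show ?thesis by (simp only: inf_absorb2)
qed

text \<open>Matrices are passed to functions on index pairs, which carry the product topology. The
  default 0 outside the \<open>d\<close> by \<open>d\<close> range discards unspecified
  entries.\<close>

definition entries :: "nat \<Rightarrow> complex mat \<Rightarrow> nat \<times> nat \<Rightarrow> complex" where
  "entries d A p = (if fst p < d \<and> snd p < d then A $$ p else 0)"

lemma mat_entries: "A \<in> carrier_mat d d \<Longrightarrow> mat d d (entries d A) = A"
  by (auto simp: entries_def intro!: eq_matI)

text \<open>The entry bound puts these functions into the unit box, inside which support, Hermitian
  symmetry, nonnegativity of the form and the trace bound are closed conditions.\<close>

lemma compact_psd_entries: "compact (entries d ` {A. psd_mat d A \<and> Re (mat_tr A) \<le> 1})"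
proof -
  let ?box = "{f :: nat \<times> nat \<Rightarrow> complex. \<forall>p. cmod (f p) \<le> 1}"
  let ?c = "{f :: nat \<times> nat \<Rightarrow> complex. (\<forall>p. p \<notin> {..<d} \<times> {..<d} \<longrightarrow> f p = 0)
    \<and> (\<forall>i\<in>{..<d}. \<forall>j\<in>{..<d}. f (i,j) = cnj (f (j,i)))
    \<and> (\<forall>v\<in>carrier_vec d. 0 \<le> Re (\<Sum>i<d. \<Sum>j<d. f (i,j) * v $ j * cnj (v $ i)))
    \<and> Re (\<Sum>i<d. f (i,i)) \<le> 1}"
  have eq: "entries d ` {A. psd_mat d A \<and> Re (mat_tr A) \<le> 1} = ?box \<inter> ?c" (is "?l = _")
  proof
    show "?l \<subseteq> ?box \<inter> ?c"
    proof
      fix f assume "f \<in> ?l"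
      then obtain A where f: "f = entries d A" and A: "psd_mat d A" "Re (mat_tr A) \<le> 1" by blast
      have "cmod (entries d A p) \<le> 1" for p
        using order_trans[OF psd_entry_bound[OF A(1), of "fst p" "snd p"] A(2)] by (simp add: entries_def)
      then have "entries d A \<in> ?box" by blast
      moreover
      have H: "hermitian_mat d A" and c: "A \<in> carrier_mat d d"
        using A by (auto simp: psd_mat_def psd_carrier)
      have q: "0 \<le> Re (\<Sum>i<d. \<Sum>j<d. A $$ (i,j) * v $ j * cnj (v $ i))" if "v \<in> carrier_vec d" for v
        using A(1) that qform_sum[OF c that] unfolding psd_mat_qform by metis
      have e: "entries d A (i,j) = A $$ (i,j)" if "i < d" "j < d" for i j
        using that by (simp add: entries_def)
      have "entries d A \<in> ?c"
      proof (intro CollectI conjI ballI allI impI)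
        show "entries d A p = 0" if "p \<notin> {..<d} \<times> {..<d}" for p
          using that by (cases p) (auto simp: entries_def)
        show "entries d A (i,j) = cnj (entries d A (j,i))" if "i \<in> {..<d}" "j \<in> {..<d}" for i j
          using that by (simp add: e hermitian_cnj[OF H])
        show "Re (\<Sum>i<d. entries d A (i,i)) \<le> 1"
          using A c by (simp add: e mat_tr_def)
        fix v :: "complex vec" assume v: "v \<in> carrier_vec d"
        have "(\<Sum>i<d. \<Sum>j<d. entries d A (i,j) * v $ j * cnj (v $ i))
          = (\<Sum>i<d. \<Sum>j<d. A $$ (i,j) * v $ j * cnj (v $ i))"
          by (intro sum.cong refl) (simp add: e)
        then show "0 \<le> Re (\<Sum>i<d. \<Sum>j<d. entries d A (i,j) * v $ j * cnj (v $ i))"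
          using q[OF v] by simp
      qed
      ultimately show "f \<in> ?box \<inter> ?c" unfolding f by blast
    qed
    show "?box \<inter> ?c \<subseteq> ?l"
    proof
      fix f assume f: "f \<in> ?box \<inter> ?c"
      then have "f \<in> ?c" by (rule IntD2)
      note fc = this[unfolded mem_Collect_eq]
      have c: "mat d d f \<in> carrier_mat d d" by simp
      have q: "qform (mat d d f) v = Re (\<Sum>i<d. \<Sum>j<d. f (i,j) * v $ j * cnj (v $ i))"
        if "v \<in> carrier_vec d" for v
        unfolding qform_sum[OF c that] by (intro arg_cong[where f = Re] sum.cong refl) simp
      have "hermitian_mat d (mat d d f)"
        unfolding hermitian_mat_iff
      proof (intro conjI c allI impI)
        fix i j assume ij: "i < d" "j < d"
        then have "f (i,j) = cnj (f (j,i))" 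
          using fc[THEN conjunct2, THEN conjunct1, THEN bspec, of i, THEN bspec, of j]
          by (simp only: lessThan_iff)
        then show "mat d d f $$ (i,j) = cnj (mat d d f $$ (j,i))" using ij by simp
      qed
      moreover have "0 \<le> qform (mat d d f) v" if "v \<in> carrier_vec d" for v
        unfolding q[OF that] using fc[THEN conjunct2, THEN conjunct2, THEN conjunct1] that by (rule bspec)
      ultimately have "psd_mat d (mat d d f)" unfolding psd_mat_qform by blast
      moreover have "Re (mat_tr (mat d d f)) \<le> 1" 
        using fc[THEN conjunct2, THEN conjunct2, THEN conjunct2] by (simp add: mat_tr_def)
      moreover have "f = entries d (mat d d f)" using fc[THEN conjunct1] by (auto simp: entries_def)
      ultimately show "f \<in> ?l" by blast
    qed
  qed
  have "closed ?c"
    unfolding Ball_def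
    by (intro closed_Collect_conj closed_Collect_all closed_Collect_imp open_Collect_const
        closed_Collect_le closed_Collect_eq continuous_intros continuous_on_product_coordinates)
  then show ?thesis unfolding eq by (intro compact_Int_closed compact_box_fun)
qed

text \<open>For Hermitian \<open>W\<close> the trace pairing is the inner product of entry families,
  the form in which \<open>min_norm_point\<close> delivers its inequality.\<close>

lemma tr_mult_hermitian:
  assumes W: "hermitian_mat N W" and U: "U \<in> carrier_mat N N"
  shows "mat_tr (W * U) = (\<Sum>p\<in>{..<N}\<times>{..<N}. cnj (W $$ p) * U $$ p)"
proof -
  have "mat_tr (W * U) = (\<Sum>j<N. \<Sum>i<N. cnj (W $$ (j,i)) * U $$ (j,i))"
    unfolding mat_tr_mult[OF hermitian_carrier[OF W] U]
    by (subst sum.swap) (intro sum.cong refl, simp add: hermitian_cnj[OF W])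
  then show ?thesis by (simp add: sum.cartesian_product)
qed

lemma hermitian_tr_square:
  assumes W: "hermitian_mat N W"
  shows "Re (mat_tr (W * W)) = (\<Sum>p\<in>{..<N}\<times>{..<N}. (cmod (W $$ p))\<^sup>2)"
  unfolding tr_mult_hermitian[OF W hermitian_carrier[OF W]] Re_sum
  by (intro sum.cong refl) (metis complex_norm_square Re_complex_of_real mult.commute)

text \<open>The nearest point argument applied to all \<open>L A - Z\<close>, parametrised by the
  entries of \<open>A\<close> and \<open>Z\<close>. Fixing the total trace makes the parameter set
  compact without destroying convexity.\<close>

lemma min_norm_difference:
  assumes N: "0 < N"
    and carr: "\<And>X. X \<in> carrier_mat d d \<Longrightarrow> L X \<in> carrier_mat N N"
    and herm: "\<And>X. hermitian_mat d X \<Longrightarrow> hermitian_mat N (L X)"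
    and lin: "\<And>X Y s t. X \<in> carrier_mat d d \<Longrightarrow> Y \<in> carrier_mat d d \<Longrightarrow>
      L (s \<cdot>\<^sub>m X + t \<cdot>\<^sub>m Y) = s \<cdot>\<^sub>m L X + t \<cdot>\<^sub>m L Y"
    and cont: "\<And>i j. i < N \<Longrightarrow> j < N \<Longrightarrow> continuous_on UNIV (\<lambda>f. L (mat d d f) $$ (i,j))"
  obtains A Z where "psd_mat d A" "psd_mat N Z" "Re (mat_tr A) + Re (mat_tr Z) = 1"
    "\<And>A' Z'. psd_mat d A' \<Longrightarrow> psd_mat N Z' \<Longrightarrow> Re (mat_tr A') + Re (mat_tr Z') = 1 \<Longrightarrow>
      Re (mat_tr ((L A - Z) * (L A - Z))) \<le> Re (mat_tr ((L A - Z) * (L A' - Z')))"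
proof -
  let ?I = "{..<N} \<times> {..<N}"
  let ?E = "\<lambda>k. entries k ` {A. psd_mat k A \<and> Re (mat_tr A) \<le> 1}"
  define H where "H = {p :: (nat \<times> nat \<Rightarrow> complex) \<times> (nat \<times> nat \<Rightarrow> complex).
    Re (\<Sum>i<d. fst p (i,i)) + Re (\<Sum>i<N. snd p (i,i)) = 1}"
  define C where "C = (?E d \<times> ?E N) \<inter> H"
  have coord: "continuous_on S (\<lambda>p. fst p i)" "continuous_on S (\<lambda>p. snd p i)"
    for S :: "((nat \<times> nat \<Rightarrow> complex) \<times> (nat \<times> nat \<Rightarrow> complex)) set" and i
    by (rule continuous_on_compose2[OF continuous_on_product_coordinates], intro continuous_intros, simp)+
  have "closed H"
    unfolding H_def by (intro closed_Collect_eq continuous_intros coord)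
  then have compact: "compact C"
    unfolding C_def by (intro compact_Int_closed compact_Times compact_psd_entries)
  have trE: "(\<Sum>i<k. entries k A (i,i)) = mat_tr A" if "A \<in> carrier_mat k k" for k A
    using that by (simp add: mat_tr_def entries_def)
  have C_iff: "p \<in> C \<longleftrightarrow> (\<exists>A Z. p = (entries d A, entries N Z) \<and> psd_mat d A \<and> psd_mat N Z
      \<and> Re (mat_tr A) + Re (mat_tr Z) = 1)" for p
  proof
    assume "p \<in> C"
    then obtain A Z where "psd_mat d A" "psd_mat N Z" "p = (entries d A, entries N Z)" "p \<in> H"
      unfolding C_def by blast
    then show "\<exists>A Z. p = (entries d A, entries N Z) \<and> psd_mat d A \<and> psd_mat N Z
      \<and> Re (mat_tr A) + Re (mat_tr Z) = 1"
      by (auto simp: H_def trE psd_carrier simp del: Re_sum)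
  next
    assume "\<exists>A Z. p = (entries d A, entries N Z) \<and> psd_mat d A \<and> psd_mat N Z
      \<and> Re (mat_tr A) + Re (mat_tr Z) = 1"
    then obtain A Z where p: "p = (entries d A, entries N Z)" "psd_mat d A" "psd_mat N Z"
      "Re (mat_tr A) + Re (mat_tr Z) = 1" by blast
    \<comment> \<open>Both traces are nonnegative with sum 1, so each obeys the separate
      bound.\<close>
    moreover have "Re (mat_tr A) \<le> 1" "Re (mat_tr Z) \<le> 1"
      using p psd_tr_nonneg[of d A] psd_tr_nonneg[of N Z] by auto
    ultimately show "p \<in> C"
      by (auto simp: C_def H_def trE psd_carrier simp del: Re_sum)
  qed
  define F where "F = (\<lambda>p i. L (mat d d (fst p)) $$ i - (snd p i :: complex))"
  have Fe: "F (entries d A, entries N Z) i = (L A - Z) $$ i"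
    if "psd_mat d A" "psd_mat N Z" "i \<in> ?I" for A Z i
    using that carr[OF psd_carrier[OF that(1)]] psd_carrier[OF that(2)]
    by (auto simp: F_def mat_entries[OF psd_carrier[OF that(1)]]) (simp add: entries_def)
  have contF: "continuous_on C (\<lambda>p. F p i)" if "i \<in> ?I" for i
  proof -
    have "continuous_on UNIV (\<lambda>f. L (mat d d f) $$ i)" using cont that by auto
    then have "continuous_on C (\<lambda>p. L (mat d d (fst p)) $$ i)"
      by (rule continuous_on_compose2) (auto intro: continuous_intros)
    then show ?thesis unfolding F_def by (intro continuous_intros coord)
  qed
  have ne: "C \<noteq> {}"
  proof -
    \<comment> \<open>The pair of the zero matrix and a rank one projection is admissible; this is
      where \<open>0 < N\<close> enters.\<close>
    define e :: "complex vec" where "e = unit_vec N 0"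
    have "mat_tr (outer e) = (\<Sum>i<N. if i = 0 then 1 else 0)"
      unfolding mat_tr_def
    proof (rule sum.cong)
      show "{..<dim_row (outer e)} = {..<N}" by (simp add: outer_def e_def)
    qed (auto simp: outer_def e_def unit_vec_def)
    then have "Re (mat_tr (0\<^sub>m d d)) + Re (mat_tr (outer e)) = 1" using N by (simp add: mat_tr_def)
    moreover have "psd_mat N (outer e)" by (intro psd_outer) (simp add: e_def)
    ultimately show ?thesis using C_iff psd_zero by blast
  qed
  have conv: "\<exists>z\<in>C. \<forall>i\<in>?I. F z i = of_real (1 - t) * F x i + of_real t * F y i"
    if xy: "x \<in> C" "y \<in> C" and t: "0 \<le> t" "t \<le> 1" for x y t
  proof -
    obtain A Z where x: "x = (entries d A, entries N Z)" and AZ: "psd_mat d A" "psd_mat N Z"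
      "Re (mat_tr A) + Re (mat_tr Z) = 1" using xy(1) C_iff by blast
    obtain A' Z' where y: "y = (entries d A', entries N Z')" and AZ': "psd_mat d A'" "psd_mat N Z'"
      "Re (mat_tr A') + Re (mat_tr Z') = 1" using xy(2) C_iff by blast
    let ?m = "\<lambda>A A'. complex_of_real (1 - t) \<cdot>\<^sub>m A + complex_of_real t \<cdot>\<^sub>m A'"
    have c: "A \<in> carrier_mat d d" "A' \<in> carrier_mat d d" "Z \<in> carrier_mat N N" "Z' \<in> carrier_mat N N"
      using AZ AZ' by (auto simp: psd_carrier)
    have p: "psd_mat d (?m A A')" "psd_mat N (?m Z Z')"
      using t by (intro psd_add psd_smult AZ AZ'; simp)+
    have trm: "Re (mat_tr (?m X X')) = (1 - t) * Re (mat_tr X) + t * Re (mat_tr X')"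
      if "X \<in> carrier_mat k k" "X' \<in> carrier_mat k k" for X X' k
      using that by (simp add: mat_tr_add[of _ k] mat_tr_smult)
    have "Re (mat_tr (?m A A')) + Re (mat_tr (?m Z Z')) =
        (1 - t) * (Re (mat_tr A) + Re (mat_tr Z)) + t * (Re (mat_tr A') + Re (mat_tr Z'))"
      unfolding trm[OF c(1,2)] trm[OF c(3,4)] by (simp add: algebra_simps)
    also have "\<dots> = 1" using AZ AZ' by simp
    finally have "(entries d (?m A A'), entries N (?m Z Z')) \<in> C" using p C_iff by blast
    moreover have "F (entries d (?m A A'), entries N (?m Z Z')) i
        = of_real (1 - t) * F x i + of_real t * F y i" if i: "i \<in> ?I" for i
      unfolding x y Fe[OF p i] Fe[OF AZ(1,2) i] Fe[OF AZ'(1,2) i] lin[OF c(1,2)]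
      using i carr[OF c(1)] carr[OF c(2)] c by (auto simp: algebra_simps)
    ultimately show ?thesis by blast
  qed
  obtain w where w: "w \<in> C"
    and min: "\<And>u. u \<in> C \<Longrightarrow> (\<Sum>i\<in>?I. (cmod (F w i))\<^sup>2) \<le> Re (\<Sum>i\<in>?I. cnj (F w i) * F u i)"
    using min_norm_point[OF compact ne contF conv] by blast
  obtain A Z where wAZ: "w = (entries d A, entries N Z)" and AZ: "psd_mat d A" "psd_mat N Z"
    "Re (mat_tr A) + Re (mat_tr Z) = 1" using w C_iff by blast
  have H: "hermitian_mat N (L A - Z)"
    using AZ by (intro hermitian_minus herm) (auto simp: psd_mat_def)
  have "Re (mat_tr ((L A - Z) * (L A - Z))) \<le> Re (mat_tr ((L A - Z) * (L A' - Z')))"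
    if AZ': "psd_mat d A'" "psd_mat N Z'" "Re (mat_tr A') + Re (mat_tr Z') = 1" for A' Z'
  proof -
    have c: "L A' - Z' \<in> carrier_mat N N"
      using carr[OF psd_carrier[OF AZ'(1)]] psd_carrier[OF AZ'(2)] by (simp add: minus_carrier_mat)
    have "(entries d A', entries N Z') \<in> C" using AZ' C_iff by blast
    from min[OF this] show ?thesis
      unfolding wAZ hermitian_tr_square[OF H] tr_mult_hermitian[OF H c]
      by (simp add: Fe[OF AZ(1,2)] Fe[OF AZ'(1,2)] del: Re_sum cong: sum.cong)
  qed
  then show thesis using that AZ by blast
qed

text \<open>Hypothesis \<open>no\<close> keeps the origin out of the normalised set of all
  \<open>L A - Z\<close>, so the nearest point \<open>W\<close> pairs strictly positively with the
  whole set. The choice \<open>A' = 0\<close> shows that \<open>W\<close> is negative definite, the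
  choice \<open>Z' = 0\<close> that it is positive on every \<open>L A\<close> with nonzero
  \<open>A\<close>; hence \<open>Y\<close> is \<open>W\<close> with its sign reversed.\<close>

lemma cone_alternative:
  assumes N: "0 < N"
    and carr: "\<And>X. X \<in> carrier_mat d d \<Longrightarrow> L X \<in> carrier_mat N N"
    and herm: "\<And>X. hermitian_mat d X \<Longrightarrow> hermitian_mat N (L X)"
    and lin: "\<And>X Y s t. X \<in> carrier_mat d d \<Longrightarrow> Y \<in> carrier_mat d d \<Longrightarrow>
      L (s \<cdot>\<^sub>m X + t \<cdot>\<^sub>m Y) = s \<cdot>\<^sub>m L X + t \<cdot>\<^sub>m L Y"
    and cont: "\<And>i j. i < N \<Longrightarrow> j < N \<Longrightarrow> continuous_on UNIV (\<lambda>f. L (mat d d f) $$ (i,j))"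
    and no: "\<And>A. psd_mat d A \<Longrightarrow> psd_mat N (L A) \<Longrightarrow> A = 0\<^sub>m d d"
  obtains Y where "pd_mat N Y"
    "\<And>A. psd_mat d A \<Longrightarrow> A \<noteq> 0\<^sub>m d d \<Longrightarrow> Re (mat_tr (Y * L A)) < 0"
proof -
  obtain A Z where AZ: "psd_mat d A" "psd_mat N Z" "Re (mat_tr A) + Re (mat_tr Z) = 1"
    and min: "\<And>A' Z'. psd_mat d A' \<Longrightarrow> psd_mat N Z' \<Longrightarrow> Re (mat_tr A') + Re (mat_tr Z') = 1 \<Longrightarrow>
      Re (mat_tr ((L A - Z) * (L A - Z))) \<le> Re (mat_tr ((L A - Z) * (L A' - Z')))"
    using min_norm_difference[OF N carr herm lin cont] by blast
  define W where "W = L A - Z"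
  have cLA: "L A \<in> carrier_mat N N" and cZ: "Z \<in> carrier_mat N N"
    using AZ carr by (auto simp: psd_carrier)
  have H: "hermitian_mat N W"
    unfolding W_def using AZ by (intro hermitian_minus herm) (auto simp: psd_mat_def)
  then have cW: "W \<in> carrier_mat N N" by (rule hermitian_carrier)
  have L0: "L (0\<^sub>m d d) = 0\<^sub>m N N"
  proof -
    have "L (0 \<cdot>\<^sub>m 0\<^sub>m d d + 0 \<cdot>\<^sub>m 0\<^sub>m d d) = 0 \<cdot>\<^sub>m L (0\<^sub>m d d) + 0 \<cdot>\<^sub>m L (0\<^sub>m d d)"
      by (rule lin) auto
    moreover have "0 \<cdot>\<^sub>m 0\<^sub>m d d + 0 \<cdot>\<^sub>m 0\<^sub>m d d = (0\<^sub>m d d :: complex mat)" by (intro eq_matI) auto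
    moreover have "0 \<cdot>\<^sub>m L (0\<^sub>m d d) + 0 \<cdot>\<^sub>m L (0\<^sub>m d d) = 0\<^sub>m N N"
      using carr[of "0\<^sub>m d d"] by (intro eq_matI) auto
    ultimately show ?thesis by simp
  qed
  have pos: "0 < Re (mat_tr (W * W))"
  proof -
    \<comment> \<open>If \<open>W\<close> vanished, \<open>L A = Z\<close> would be positive
      semidefinite, so \<open>A\<close> and then \<open>Z\<close> would be zero, against total trace
      one.\<close>
    have "W \<noteq> 0\<^sub>m N N"
    proof
      assume "W = 0\<^sub>m N N"
      then have "(L A) $$ (i,j) = Z $$ (i,j)" if "i < N" "j < N" for i j
        using that cLA cZ unfolding W_def
        by (metis carrier_matD diff_eq_diff_eq index_minus_mat(1) index_zero_mat(1) right_minus_eq)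
      then have LZ: "L A = Z" using cLA cZ by (intro eq_matI) auto
      then have "A = 0\<^sub>m d d" using no AZ by simp
      then have "Z = 0\<^sub>m N N" using LZ L0 by simp
      then show False using \<open>A = 0\<^sub>m d d\<close> AZ(3) by (simp add: mat_tr_def)
    qed
    then obtain i j where ij: "i < N" "j < N" "W $$ (i,j) \<noteq> 0"
      using cW by (metis carrier_matD eq_matI index_zero_mat)
    then show ?thesis
      unfolding hermitian_tr_square[OF H] by (intro sum_pos2[of _ "(i,j)"]) auto
  qed
  have key: "0 < Re (mat_tr (W * (L A' - Z')))"
    if "psd_mat d A'" "psd_mat N Z'" "Re (mat_tr A') + Re (mat_tr Z') = 1" for A' Z'
    using min[OF that] pos unfolding W_def by simp
  define Y where "Y = complex_of_real (-1) \<cdot>\<^sub>m W"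
  have cY: "Y \<in> carrier_mat N N" using cW by (simp add: Y_def)
  have trY: "Re (mat_tr (Y * X)) = - Re (mat_tr (W * X))" if "X \<in> carrier_mat N N" for X
    using that cW cY by (simp add: mat_tr_mult[of _ N N] Y_def sum_negf)
  have trWs: "Re (mat_tr (W * (complex_of_real s \<cdot>\<^sub>m X))) = s * Re (mat_tr (W * X))"
    if "X \<in> carrier_mat N N" for s X
    using that mat_tr_smult[OF mult_carrier_mat[OF cW that], of "complex_of_real s"]
    by (simp add: mult_smult_distrib[OF cW that])
  have trpos: "0 < Re (mat_tr X)" if "psd_mat k X" "X \<noteq> 0\<^sub>m k k" for X k
    using psd_tr_nonneg[OF that(1)] psd_tr_zero[OF that(1)] that(2) by fastforce
  have "pd_mat N Y"
    unfolding pd_mat_def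
  proof (intro conjI ballI impI)
    show "hermitian_mat N Y" unfolding Y_def using H by (rule hermitian_smult)
    fix v :: "complex vec" assume v: "v \<in> carrier_vec N" "v \<noteq> 0\<^sub>v N"
    then obtain i where i: "i < N" "v $ i \<noteq> 0" by (auto simp: vec_eq_iff)
    then have "outer v $$ (i,i) \<noteq> 0" using v by (simp add: outer_def)
    then have nz: "outer v \<noteq> 0\<^sub>m N N" using i by auto
    define \<tau> where "\<tau> = Re (mat_tr (outer v))"
    have \<tau>: "0 < \<tau>" unfolding \<tau>_def by (rule trpos[OF psd_outer[OF v(1)] nz])
    \<comment> \<open>Rescaling to trace one makes the pair of zero and \<open>?Z\<close> admissible
      in \<open>key\<close>.\<close>
    let ?Z = "complex_of_real (1 / \<tau>) \<cdot>\<^sub>m outer v"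
    have "psd_mat N ?Z" using \<tau> v by (intro psd_smult psd_outer) auto
    moreover have "Re (mat_tr (0\<^sub>m d d)) + Re (mat_tr ?Z) = 1"
      using \<tau> by (simp add: mat_tr_smult[OF outer_carrier[OF v(1)]] \<tau>_def[symmetric]) (simp add: mat_tr_def)
    ultimately have "0 < Re (mat_tr (W * (L (0\<^sub>m d d) - ?Z)))" by (intro key psd_zero)
    also have "L (0\<^sub>m d d) - ?Z = complex_of_real (- 1 / \<tau>) \<cdot>\<^sub>m outer v"
      unfolding L0 using carrier_matD[OF outer_carrier[OF v(1)]] by (intro eq_matI) auto
    finally have "0 < (- 1 / \<tau>) * qform W v"
      unfolding trWs[OF outer_carrier[OF v(1)]] qform_outer[OF cW v(1)] .
    then have "qform W v < 0" using \<tau> by (simp add: zero_less_mult_iff divide_less_0_iff)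
    then show "0 < qform Y v" unfolding Y_def qform_smult[OF cW v(1)] by simp
  qed
  moreover have "Re (mat_tr (Y * L X)) < 0" if X: "psd_mat d X" "X \<noteq> 0\<^sub>m d d" for X
  proof -
    define \<tau> where "\<tau> = Re (mat_tr X)"
    have cX: "X \<in> carrier_mat d d" using X by (simp add: psd_carrier)
    have \<tau>: "0 < \<tau>" unfolding \<tau>_def by (rule trpos[OF X])
    let ?X = "complex_of_real (1 / \<tau>) \<cdot>\<^sub>m X"
    have "psd_mat d ?X" using \<tau> X by (intro psd_smult) auto
    moreover have "Re (mat_tr ?X) + Re (mat_tr (0\<^sub>m N N)) = 1"
      using \<tau> by (simp add: mat_tr_smult[OF cX] \<tau>_def[symmetric]) (simp add: mat_tr_def)
    ultimately have "0 < Re (mat_tr (W * (L ?X - 0\<^sub>m N N)))" by (intro key psd_zero)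
    also have "L ?X - 0\<^sub>m N N = complex_of_real (1 / \<tau>) \<cdot>\<^sub>m L X"
    proof -
      have "?X = complex_of_real (1 / \<tau>) \<cdot>\<^sub>m X + 0 \<cdot>\<^sub>m X" using cX by (intro eq_matI) auto
      then have "L ?X = complex_of_real (1 / \<tau>) \<cdot>\<^sub>m L X + 0 \<cdot>\<^sub>m L X" using lin[OF cX cX] by metis
      then show ?thesis using carr[OF cX] by (intro eq_matI) auto
    qed
    finally have "0 < (1 / \<tau>) * Re (mat_tr (W * L X))"
      unfolding trWs[OF carr[OF cX]] .
    then show ?thesis using \<tau> by (simp add: trY[OF carr[OF cX]] zero_less_mult_iff zero_less_divide_iff)
  qed
  ultimately show thesis using that by blast
qed

section \<open>Upper bound\<close>

text \<open>With \<open>G = (B\<^sup>* Q B)\<^sup>-\<^sup>1\<close>, at \<open>z = Q w\<close> the form of \<open>Q\<^sup>-\<^sup>1 - B G B\<^sup>*\<close> is the form of \<open>Q\<close> at \<open>w - B G B\<^sup>* z\<close>.\<close>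

lemma shorted_inverse_psd:
  assumes Q: "pd_mat N Q" and Qi: "hermitian_mat N Qi" "Q * Qi = 1\<^sub>m N"
    and B: "B \<in> carrier_mat N d"
    and G: "hermitian_mat d G" "(mat_adjoint B * Q * B) * G = 1\<^sub>m d"
  shows "psd_mat N (Qi - B * G * mat_adjoint B)"
  unfolding psd_mat_qform
proof (intro conjI ballI)
  note cQ = pd_carrier[OF Q] and cQi = hermitian_carrier[OF Qi(1)] and cG = hermitian_carrier[OF G(1)]
  have HQ: "hermitian_mat N Q" using Q by (simp add: pd_mat_def)
  have cB: "mat_adjoint B \<in> carrier_mat d N" using B by simp
  have HB: "hermitian_mat N (B * G * mat_adjoint B)"
    using hermitian_congruence[OF G(1) cB] by simp
  show "hermitian_mat N (Qi - B * G * mat_adjoint B)" by (intro hermitian_minus Qi HB)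
  fix z :: "complex vec" assume z: "z \<in> carrier_vec N"
  define w u y where "w = Qi *\<^sub>v z" and "u = mat_adjoint B *\<^sub>v z" and "y = G *\<^sub>v u"
  have w: "w \<in> carrier_vec N" and u: "u \<in> carrier_vec d" and y: "y \<in> carrier_vec d"
    unfolding w_def u_def y_def by (intro mult_mat_vec_carrier[OF cQi z] mult_mat_vec_carrier[OF cG] mult_mat_vec_carrier[OF cB z])+
  have By: "B *\<^sub>v y \<in> carrier_vec N" by (rule mult_mat_vec_carrier[OF B y])
  have Qw: "Q *\<^sub>v w = z" using assoc_mult_mat_vec[OF cQ cQi z] Qi(2) z by (simp add: w_def)
  have cC: "mat_adjoint B * Q * B \<in> carrier_mat d d" by (intro mult_carrier_mat[OF mult_carrier_mat[OF cB cQ] B])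
  have Cy: "(mat_adjoint B * Q * B) *\<^sub>v y = u"
    using assoc_mult_mat_vec[OF cC cG u] G(2) u by (simp add: y_def)
  have zB: "z \<bullet>c (B *\<^sub>v y) = u \<bullet>c y"
    using adjoint_sesq[OF cB z y] by (simp add: u_def)
  have Gu: "Re (u \<bullet>c y) = qform G u"
    using adjoint_sesq[OF cG u u] G(1) by (simp add: qform_def y_def hermitian_mat_def)
  have "qform Q w = qform Qi z"
    using adjoint_sesq[OF cQi z z] Qi(1) Qw by (simp add: qform_def w_def[symmetric] hermitian_mat_def)
  moreover have "qform Q (B *\<^sub>v y) = qform G u"
    using qform_congruence[OF cQ B y] Cy Gu by (simp add: qform_def)
  \<comment> \<open>The cross term and the last term both reduce to \<open>qform G u\<close>, so the
    square equals \<open>qform Qi z - qform G u\<close>.\<close>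
  moreover have "qform Q (w - 1 \<cdot>\<^sub>v (B *\<^sub>v y)) = qform Q w - 2 * qform G u + qform Q (B *\<^sub>v y)"
    using qform_diff[OF HQ w By, of 1] by (simp add: Qw zB Gu)
  moreover have "qform (B * G * mat_adjoint B) z = qform G u"
    using qform_congruence[OF cG cB z] by (simp add: u_def)
  moreover have "0 \<le> qform Q (w - 1 \<cdot>\<^sub>v (B *\<^sub>v y))"
    using pd_imp_psd[OF Q] w By by (simp add: psd_mat_qform)
  ultimately show "0 \<le> qform (Qi - B * G * mat_adjoint B) z"
    using qform_minus[OF cQi hermitian_carrier[OF HB] z] by simp
qed

text \<open>The trace of \<open>Y\<close> over the range of \<open>B\<close>, measured in the inner
  product \<open>Q\<close>, exceeds \<open>k * d\<close> by \<open>cert\<close>; over the whole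
  space it equals \<open>m\<close>. Semidefiniteness of \<open>?P\<close> compares the two.\<close>

lemma dim_bound_of_certificate:
  assumes Y: "pd_mat (m * n) Y" and n: "0 < n" and d: "0 < d"
    and B: "B \<in> carrier_mat (m * n) d"
    and inj: "\<And>w. w \<in> carrier_vec d \<Longrightarrow> B *\<^sub>v w = 0\<^sub>v (m * n) \<Longrightarrow> w = 0\<^sub>v d"
    and cert: "\<And>w. w \<in> carrier_vec d \<Longrightarrow> w \<noteq> 0\<^sub>v d \<Longrightarrow>
      real k * qform (ampl n (ptrace m n Y)) (B *\<^sub>v w) < qform Y (B *\<^sub>v w)"
  shows "d * k < m"
proof -
  define T where "T = ptrace m n Y"
  define Q where "Q = ampl n T"
  have T: "pd_mat m T" unfolding T_def by (rule pd_ptrace[OF Y n])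
  have Q: "pd_mat (m * n) Q" unfolding Q_def by (rule pd_ampl[OF T])
  obtain V where V: "pd_mat m V" "T * V = 1\<^sub>m m" using pd_inverse[OF T] by blast
  note cT = pd_carrier[OF T] and cV = pd_carrier[OF V(1)] and cQ = pd_carrier[OF Q] and cY = pd_carrier[OF Y]
  have QV: "Q * ampl n V = 1\<^sub>m (m * n)"
    unfolding Q_def ampl_mult[OF cT cV] V(2) by (rule ampl_one)
  have HV: "hermitian_mat (m * n) (ampl n V)" using pd_ampl[OF V(1)] by (simp add: pd_mat_def)
  define C where "C = mat_adjoint B * Q * B"
  have C: "pd_mat d C" unfolding C_def by (rule pd_congruence[OF Q B inj])
  obtain G where G: "pd_mat d G" "C * G = 1\<^sub>m d" using pd_inverse[OF C] by blast
  note cC = pd_carrier[OF C] and cG = pd_carrier[OF G(1)]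
  have cB: "mat_adjoint B \<in> carrier_mat d (m * n)" using B by simp
  let ?P = "ampl n V - B * G * mat_adjoint B"
  have cBG: "B * G \<in> carrier_mat (m * n) d" using B cG by simp
  have cBGB: "B * G * mat_adjoint B \<in> carrier_mat (m * n) (m * n)" using cBG cB by simp
  have "psd_mat (m * n) ?P"
    using G C_def by (intro shorted_inverse_psd[OF Q HV QV B]) (auto simp: pd_mat_def)
  then have "0 \<le> Re (mat_tr (Y * ?P))" by (rule tr_pd_psd_nonneg[OF Y])
  also have "Y * ?P = Y * ampl n V - Y * (B * G * mat_adjoint B)"
    by (rule mult_minus_distrib_mat[OF cY ampl_carrier[OF cV] cBGB])
  also have "mat_tr \<dots> = mat_tr (Y * ampl n V) - mat_tr (Y * (B * G * mat_adjoint B))"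
    using cY ampl_carrier[OF cV, of n] cBGB by (intro mat_tr_minus[of _ "m * n"]) auto
  \<comment> \<open>By adjointness this is the trace of \<open>T * V\<close>, the identity of size
    \<open>m\<close>. Here it matters that \<open>T\<close> is the partial trace of \<open>Y\<close>
    itself.\<close>
  also have "mat_tr (Y * ampl n V) = of_nat m"
    unfolding tr_mult_ampl[OF cY cV] T_def[symmetric] V(2) by (simp add: mat_tr_def)
  also have "mat_tr (Y * (B * G * mat_adjoint B)) = mat_tr ((mat_adjoint B * Y * B) * G)"
  proof -
    have "Y * (B * G * mat_adjoint B) = Y * (B * G) * mat_adjoint B"
      using assoc_mult_mat[OF cY cBG cB] by simp
    also have "mat_tr \<dots> = mat_tr (mat_adjoint B * (Y * (B * G)))"
      using cY cBG cB by (intro mat_tr_comm) auto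
    also have "mat_adjoint B * (Y * (B * G)) = (mat_adjoint B * Y) * (B * G)"
      using assoc_mult_mat[OF cB cY cBG] by simp
    also have "\<dots> = (mat_adjoint B * Y * B) * G"
      using assoc_mult_mat[OF mult_carrier_mat[OF cB cY] B cG] by simp
    finally show ?thesis .
  qed
  finally have le: "Re (mat_tr ((mat_adjoint B * Y * B) * G)) \<le> real m" by simp
  have cA: "mat_adjoint B * Y * B \<in> carrier_mat d d" by (intro mult_carrier_mat[OF mult_carrier_mat[OF cB cY] B])
  \<comment> \<open>\<open>cert\<close> says that this matrix is positive definite. Its trace
    against \<open>G\<close> is therefore positive, and \<open>C * G = 1\<^sub>m d\<close> turns the
    subtracted part into \<open>k * d\<close>.\<close>
  let ?X = "mat_adjoint B * Y * B - complex_of_real (real k) \<cdot>\<^sub>m C"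
  have ckC: "complex_of_real (real k) \<cdot>\<^sub>m C \<in> carrier_mat d d" using cC by simp
  have "pd_mat d ?X"
    unfolding pd_mat_def
  proof (intro conjI ballI impI)
    show "hermitian_mat d ?X"
      using Y C by (intro hermitian_minus hermitian_smult hermitian_congruence[OF _ B]) (auto simp: pd_mat_def)
    fix w :: "complex vec" assume w: "w \<in> carrier_vec d" "w \<noteq> 0\<^sub>v d"
    have qC: "qform C w = qform Q (B *\<^sub>v w)"
      unfolding C_def by (rule qform_congruence[OF cQ B w(1)])
    have "qform ?X w = qform Y (B *\<^sub>v w) - real k * qform Q (B *\<^sub>v w)"
      unfolding qform_minus[OF cA ckC w(1)] qform_smult[OF cC w(1)] qform_congruence[OF cY B w(1)] qC ..
    then show "0 < qform ?X w" using cert[OF w] by (simp add: Q_def T_def)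
  qed
  \<comment> \<open>\<open>0 < d\<close> is what makes the inequality strict.\<close>
  moreover have "G \<noteq> 0\<^sub>m d d"
  proof
    assume "G = 0\<^sub>m d d"
    then have "1\<^sub>m d = (0\<^sub>m d d :: complex mat)" using G(2) cC by simp
    then have "(1\<^sub>m d :: complex mat) $$ (0,0) = 0\<^sub>m d d $$ (0,0)" by simp
    then show False using d by simp
  qed
  ultimately have "0 < Re (mat_tr (?X * G))" 
    using tr_pd_psd_pos[OF _ pd_imp_psd[OF G(1)]] by blast
  also have "?X * G = (mat_adjoint B * Y * B) * G - complex_of_real (real k) \<cdot>\<^sub>m 1\<^sub>m d"
    using minus_mult_distrib_mat[OF cA ckC cG] mult_smult_assoc_mat[OF cC cG] G(2) by simp
  also have "mat_tr \<dots> = mat_tr ((mat_adjoint B * Y * B) * G) - mat_tr (complex_of_real (real k) \<cdot>\<^sub>m 1\<^sub>m d)"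
    by (rule mat_tr_minus[OF mult_carrier_mat[OF cA cG]]) simp
  also have "mat_tr (complex_of_real (real k) \<cdot>\<^sub>m 1\<^sub>m d) = of_nat (d * k)"
    by (simp add: mat_tr_def)
  finally have "real (d * k) < real m" using le by simp
  then show ?thesis by linarith
qed

section \<open>The ampliated map in closed form and its compression to a subspace\<close>

definition reduction :: "nat \<Rightarrow> nat \<Rightarrow> nat \<Rightarrow> complex mat \<Rightarrow> complex mat" where
  "reduction m n k U = of_nat k \<cdot>\<^sub>m ampl n (ptrace m n U) - U"

lemma reduction_carrier [simp]:
  "U \<in> carrier_mat (m * n) (m * n) \<Longrightarrow> reduction m n k U \<in> carrier_mat (m * n) (m * n)"
  by (simp add: reduction_def minus_carrier_mat)

text \<open>The right-hand side is symmetric in \<open>Y\<close> and \<open>U\<close> because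
  ampliation is adjoint to the partial trace; this is the self-adjointness of the ampliated
  map.\<close>

lemma tr_mult_reduction:
  assumes Y: "Y \<in> carrier_mat (m * n) (m * n)" and U: "U \<in> carrier_mat (m * n) (m * n)"
  shows "mat_tr (Y * reduction m n k U) = of_nat k * mat_tr (ptrace m n Y * ptrace m n U) - mat_tr (Y * U)"
proof -
  let ?a = "ampl n (ptrace m n U)"
  have a: "?a \<in> carrier_mat (m * n) (m * n)" by simp
  have "Y * reduction m n k U = of_nat k \<cdot>\<^sub>m (Y * ?a) - Y * U"
    unfolding reduction_def
    using mult_minus_distrib_mat[OF Y smult_carrier_mat[OF a] U] mult_smult_distrib[OF Y a] by simp
  then have "mat_tr (Y * reduction m n k U) = of_nat k * mat_tr (Y * ?a) - mat_tr (Y * U)"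
    using mat_tr_minus[OF smult_carrier_mat[OF mult_carrier_mat[OF Y a]] mult_carrier_mat[OF Y U]]
      mat_tr_smult[OF mult_carrier_mat[OF Y a]] by simp
  then show ?thesis by (simp add: tr_mult_ampl[OF Y])
qed

lemma hermitian_reduction:
  assumes U: "hermitian_mat (m * n) U"
  shows "hermitian_mat (m * n) (reduction m n k U)"
proof -
  have "hermitian_mat (m * n) (complex_of_real (real k) \<cdot>\<^sub>m ampl n (ptrace m n U))"
    by (intro hermitian_smult hermitian_ampl hermitian_ptrace U)
  then show ?thesis unfolding reduction_def by (intro hermitian_minus U) simp
qed

lemma reduction_linear:
  assumes X: "X \<in> carrier_mat (m * n) (m * n)" and Z: "Z \<in> carrier_mat (m * n) (m * n)"
  shows "reduction m n k (s \<cdot>\<^sub>m X + t \<cdot>\<^sub>m Z) = s \<cdot>\<^sub>m reduction m n k X + t \<cdot>\<^sub>m reduction m n k Z"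
proof -
  have sX: "s \<cdot>\<^sub>m X \<in> carrier_mat (m * n) (m * n)" and tZ: "t \<cdot>\<^sub>m Z \<in> carrier_mat (m * n) (m * n)"
    and sum: "s \<cdot>\<^sub>m X + t \<cdot>\<^sub>m Z \<in> carrier_mat (m * n) (m * n)"
    using X Z by auto
  show ?thesis
    unfolding reduction_def id_tensor_R_map[OF X, symmetric] id_tensor_R_map[OF Z, symmetric]
      id_tensor_R_map[OF sum, symmetric] id_tensor_add[OF linear_R_map sX tZ]
      id_tensor_smult[OF linear_R_map X] id_tensor_smult[OF linear_R_map Z] ..
qed

lemma congruence_linear:
  fixes B :: "complex mat"
  assumes B: "B \<in> carrier_mat N d" and X: "X \<in> carrier_mat d d" and Z: "Z \<in> carrier_mat d d"
  shows "B * (s \<cdot>\<^sub>m X + t \<cdot>\<^sub>m Z) * mat_adjoint B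
    = s \<cdot>\<^sub>m (B * X * mat_adjoint B) + t \<cdot>\<^sub>m (B * Z * mat_adjoint B)"
proof -
  have cB: "mat_adjoint B \<in> carrier_mat d N" using B by simp
  have c: "B * X \<in> carrier_mat N d" "B * Z \<in> carrier_mat N d" using B X Z by auto
  have "B * (s \<cdot>\<^sub>m X + t \<cdot>\<^sub>m Z) = s \<cdot>\<^sub>m (B * X) + t \<cdot>\<^sub>m (B * Z)"
    using mult_add_distrib_mat[OF B smult_carrier_mat[OF X] smult_carrier_mat[OF Z]]
      mult_smult_distrib[OF B X] mult_smult_distrib[OF B Z] by simp
  then show ?thesis
    using add_mult_distrib_mat[OF smult_carrier_mat[OF c(1)] smult_carrier_mat[OF c(2)] cB]
      mult_smult_assoc_mat[OF c(1) cB] mult_smult_assoc_mat[OF c(2) cB] by simp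
qed

lemma congruence_outer:
  assumes B: "B \<in> carrier_mat N d" and w: "w \<in> carrier_vec d"
  shows "B * outer w * mat_adjoint B = outer (B *\<^sub>v w)"
proof (rule eq_matI)
  have Bw: "B *\<^sub>v w \<in> carrier_vec N" by (rule mult_mat_vec_carrier[OF B w])
  note dim = carrier_matD[OF outer_carrier[OF w]] carrier_matD[OF outer_carrier[OF Bw]]
  show "dim_row (B * outer w * mat_adjoint B) = dim_row (outer (B *\<^sub>v w))"
    "dim_col (B * outer w * mat_adjoint B) = dim_col (outer (B *\<^sub>v w))"
    using B dim by simp_all
  fix i j assume "i < dim_row (outer (B *\<^sub>v w))" "j < dim_col (outer (B *\<^sub>v w))"
  then have ij: "i < N" "j < N" using dim by auto
  have "(B * outer w * mat_adjoint B) $$ (i,j) = (\<Sum>q<d. \<Sum>p<d. (B $$ (i,p) * w $ p) * cnj (B $$ (j,q) * w $ q))"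
    using B w ij dim
    by (simp add: scalar_prod_def atLeast0LessThan sum_distrib_right)
      (intro sum.cong refl, simp add: outer_def)
  also have "\<dots> = (\<Sum>p<d. B $$ (i,p) * w $ p) * cnj (\<Sum>q<d. B $$ (j,q) * w $ q)"
    unfolding cnj_sum sum_product by (rule sum.swap)
  also have "\<dots> = outer (B *\<^sub>v w) $$ (i,j)"
    using B w ij by (simp add: outer_def scalar_prod_def atLeast0LessThan)
  finally show "(B * outer w * mat_adjoint B) $$ (i,j) = outer (B *\<^sub>v w) $$ (i,j)" .
qed

lemma pd_one: "pd_mat N (1\<^sub>m N)"
proof -
  have "0 < qform (1\<^sub>m N) v" if v: "v \<in> carrier_vec N" "v \<noteq> 0\<^sub>v N" for v
  proof -
    obtain i where i: "i < N" "v $ i \<noteq> 0" using v by (auto simp: vec_eq_iff)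
    have "v \<bullet>c v = (\<Sum>i<N. complex_of_real ((cmod (v $ i))\<^sup>2))"
      using v by (auto simp: scalar_prod_def atLeast0LessThan complex_norm_square simp del: of_real_power
          intro!: sum.cong)
    then have "Re (v \<bullet>c v) = (\<Sum>i<N. (cmod (v $ i))\<^sup>2)" by simp
    also have "0 < \<dots>" using i by (intro sum_pos2[of _ i]) auto
    finally show ?thesis using v by (simp add: qform_def)
  qed
  then show ?thesis by (auto simp: pd_mat_def hermitian_mat_iff)
qed

text \<open>By cyclicity this is the trace of \<open>A\<close> against the Gram matrix of the
  columns of \<open>B\<close>. It allows \<open>B * A * mat_adjoint B\<close> to be rescaled to a
  density matrix.\<close>

lemma tr_congruence_pos:
  assumes B: "B \<in> carrier_mat N d"
    and inj: "\<And>w. w \<in> carrier_vec d \<Longrightarrow> B *\<^sub>v w = 0\<^sub>v N \<Longrightarrow> w = 0\<^sub>v d"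
    and A: "psd_mat d A" "A \<noteq> 0\<^sub>m d d"
  shows "0 < Re (mat_tr (B * A * mat_adjoint B))"
proof -
  have cB: "mat_adjoint B \<in> carrier_mat d N" and cA: "A \<in> carrier_mat d d"
    using B A by (auto simp: psd_carrier)
  have "pd_mat d (mat_adjoint B * 1\<^sub>m N * B)" by (rule pd_congruence[OF pd_one B inj])
  then have "0 < Re (mat_tr (mat_adjoint B * B * A))"
    using tr_pd_psd_pos[OF _ A] right_mult_one_mat[OF cB] by simp
  also have "mat_adjoint B * B * A = mat_adjoint B * (B * A)" using assoc_mult_mat[OF cB B cA] by simp
  also have "mat_tr \<dots> = mat_tr (B * A * mat_adjoint B)" using cB B cA by (intro mat_tr_comm) auto
  finally show ?thesis .
qed

lemma continuous_congruence_entry: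
  fixes B :: "complex mat"
  assumes B: "B \<in> carrier_mat N d" and ij: "i < N" "j < N"
  shows "continuous_on UNIV (\<lambda>f. (B * mat d d f * mat_adjoint B) $$ (i,j))"
proof -
  have "(B * mat d d f * mat_adjoint B) $$ (i,j) = (\<Sum>q<d. (\<Sum>p<d. B $$ (i,p) * f (p,q)) * cnj (B $$ (j,q)))" for f
    using B ij by (simp add: scalar_prod_def atLeast0LessThan)
  then show ?thesis by (auto intro!: continuous_intros continuous_on_product_coordinates)
qed

text \<open>With a basis matrix \<open>B\<close> of \<open>S\<close>, every
  \<open>B * A * mat_adjoint B\<close> with \<open>A\<close> positive semidefinite is supported in
  \<open>S\<close>. Detection excludes nonzero \<open>A\<close> with semidefinite image, so
  \<open>cone_alternative\<close> supplies \<open>Y\<close>, and rank one \<open>A\<close> turn it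
  into the certificate.\<close>

lemma detecting_dim_bound:
  assumes det: "detecting_subspace m n (R_map k n) S" and n: "0 < n" and m: "0 < m"
  shows "subspace_dim (m * n) S * k < m"
proof (rule ccontr)
  let ?N = "m * n"
  define d where "d = subspace_dim ?N S"
  assume "\<not> subspace_dim ?N S * k < m"
  then have dk: "\<not> d * k < m" and d: "0 < d" using m by (auto simp: d_def intro: Nat.gr0I)
  have S: "is_subspace ?N S" using det by (simp add: detecting_subspace_def)
  obtain B where B: "B \<in> carrier_mat ?N d" and range: "mat_range B = S"
    and inj: "\<And>w. w \<in> carrier_vec d \<Longrightarrow> B *\<^sub>v w = 0\<^sub>v ?N \<Longrightarrow> w = 0\<^sub>v d"
    using subspace_basis_matrix[OF S] unfolding d_def by blast
  have cB: "mat_adjoint B \<in> carrier_mat d ?N" using B by simp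
  have N: "0 < ?N" using m n by simp
  define L where "L = (\<lambda>X. reduction m n k (B * X * mat_adjoint B))"
  have cBX: "B * X * mat_adjoint B \<in> carrier_mat ?N ?N" if "X \<in> carrier_mat d d" for X
    by (intro mult_carrier_mat[OF mult_carrier_mat[OF B that] cB])
  have carr: "L X \<in> carrier_mat ?N ?N" if "X \<in> carrier_mat d d" for X
    unfolding L_def by (intro reduction_carrier cBX that)
  have herm: "hermitian_mat ?N (L X)" if "hermitian_mat d X" for X
    unfolding L_def using hermitian_congruence[OF that cB] by (intro hermitian_reduction) simp
  have lin: "L (s \<cdot>\<^sub>m X + t \<cdot>\<^sub>m Y) = s \<cdot>\<^sub>m L X + t \<cdot>\<^sub>m L Y"
    if "X \<in> carrier_mat d d" "Y \<in> carrier_mat d d" for X Y s t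
    unfolding L_def congruence_linear[OF B that] by (rule reduction_linear[OF cBX[OF that(1)] cBX[OF that(2)]])
  have cont: "continuous_on UNIV (\<lambda>f. L (mat d d f) $$ (i,j))" if ij: "i < ?N" "j < ?N" for i j
  proof -
    let ?U = "\<lambda>f. B * mat d d f * mat_adjoint B"
    note b = block_index_less[OF ij(1)] block_index_less[OF ij(2)]
    \<comment> \<open>Every entry of \<open>L\<close> is a finite linear combination of entries of
      the congruence, hence continuous.\<close>
    have "L (mat d d f) $$ (i,j) = of_nat k * (if i mod n = j mod n then
        (\<Sum>a<n. ?U f $$ (i div n * n + a, j div n * n + a)) else 0) - ?U f $$ (i,j)" for f
      using ij b carrier_matD[OF cBX[of "mat d d f"]] carrier_matD[OF ampl_carrier[OF ptrace_carrier, of n m n]]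
      by (simp add: L_def reduction_def ampl_index[OF ptrace_carrier] ptrace_index)
    moreover have "continuous_on UNIV (\<lambda>f. ?U f $$ (i div n * n + a, j div n * n + a))" if "a < n" for a
      using b that by (intro continuous_congruence_entry[OF B] mat_index_less)
    ultimately show ?thesis
      using continuous_congruence_entry[OF B ij] by (cases "i mod n = j mod n") (auto intro!: continuous_intros)
  qed
  have no: "A = 0\<^sub>m d d" if A: "psd_mat d A" "psd_mat ?N (L A)" for A
  proof (rule ccontr)
    assume "A \<noteq> 0\<^sub>m d d"
    let ?U = "B * A * mat_adjoint B"
    define \<tau> where "\<tau> = Re (mat_tr ?U)"
    have \<tau>: "0 < \<tau>" unfolding \<tau>_def using tr_congruence_pos[OF B inj A(1) \<open>A \<noteq> 0\<^sub>m d d\<close>] .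
    have cA: "A \<in> carrier_mat d d" using A by (simp add: psd_carrier)
    have U: "psd_mat ?N ?U" by (rule psd_congruence'[OF A(1) B])
    then have trU: "mat_tr ?U = complex_of_real \<tau>"
      unfolding \<tau>_def by (intro mat_tr_hermitian_real) (auto simp: psd_mat_def)
    \<comment> \<open>A nonzero counterexample \<open>A\<close> yields a density matrix in
      \<open>S\<close> whose image is a positive multiple of \<open>L A\<close>, contradicting
      detection.\<close>
    define \<rho> where "\<rho> = complex_of_real (1 / \<tau>) \<cdot>\<^sub>m ?U"
    have "psd_mat ?N \<rho>" unfolding \<rho>_def using \<tau> U by (intro psd_smult) auto
    moreover have "mat_tr \<rho> = 1"
      unfolding \<rho>_def mat_tr_smult[OF cBX[OF cA]] trU using \<tau> by simp
    moreover have "mat_range \<rho> \<subseteq> S"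
    proof
      fix y assume "y \<in> mat_range \<rho>"
      then obtain v where v: "v \<in> carrier_vec ?N" "y = \<rho> *\<^sub>v v"
        using cBX[OF cA] by (auto simp: mat_range_def \<rho>_def)
      define x where "x = complex_of_real (1 / \<tau>) \<cdot>\<^sub>v (A *\<^sub>v (mat_adjoint B *\<^sub>v v))"
      have Bv: "mat_adjoint B *\<^sub>v v \<in> carrier_vec d" by (rule mult_mat_vec_carrier[OF cB v(1)])
      have ABv: "A *\<^sub>v (mat_adjoint B *\<^sub>v v) \<in> carrier_vec d" by (rule mult_mat_vec_carrier[OF cA Bv])
      then have x: "x \<in> carrier_vec d" by (simp add: x_def)
      have "y = complex_of_real (1 / \<tau>) \<cdot>\<^sub>v (?U *\<^sub>v v)"
        unfolding v(2) \<rho>_def using cBX[OF cA] v(1) by (intro eq_vecI) auto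
      also have "?U *\<^sub>v v = B *\<^sub>v (A *\<^sub>v (mat_adjoint B *\<^sub>v v))"
        using assoc_mult_mat_vec[OF mult_carrier_mat[OF B cA] cB v(1)] assoc_mult_mat_vec[OF B cA Bv] by simp
      also have "complex_of_real (1 / \<tau>) \<cdot>\<^sub>v \<dots> = B *\<^sub>v x"
        unfolding x_def using mult_mat_vec[OF B ABv] by simp
      finally show "y \<in> S" using x B unfolding range[symmetric] mat_range_def by auto
    qed
    moreover have "psd_mat ?N (id_tensor m n (R_map k n) \<rho>)"
    proof -
      have "id_tensor m n (R_map k n) \<rho> = complex_of_real (1 / \<tau>) \<cdot>\<^sub>m L A"
        unfolding \<rho>_def id_tensor_smult[OF linear_R_map cBX[OF cA]] id_tensor_R_map[OF cBX[OF cA]]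
        by (simp add: L_def reduction_def)
      then show ?thesis using psd_smult[OF A(2), of "1 / \<tau>"] \<tau> by simp
    qed
    ultimately show False using det unfolding detecting_subspace_def density_mat_def by blast
  qed
  obtain Y where Y: "pd_mat ?N Y"
    and neg: "\<And>A. psd_mat d A \<Longrightarrow> A \<noteq> 0\<^sub>m d d \<Longrightarrow> Re (mat_tr (Y * L A)) < 0"
    using cone_alternative[OF N carr herm lin cont no] by blast
  note cY = pd_carrier[OF Y]
  have "real k * qform (ampl n (ptrace m n Y)) (B *\<^sub>v w) < qform Y (B *\<^sub>v w)"
    if w: "w \<in> carrier_vec d" "w \<noteq> 0\<^sub>v d" for w
  proof -
    have x: "B *\<^sub>v w \<in> carrier_vec ?N" by (rule mult_mat_vec_carrier[OF B w(1)])
    obtain i where i: "i < d" "w $ i \<noteq> 0" using w by (auto simp: vec_eq_iff)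
    then have "outer w $$ (i,i) \<noteq> 0" using w by (simp add: outer_def)
    then have nz: "outer w \<noteq> 0\<^sub>m d d" using i by auto
    let ?O = "outer (B *\<^sub>v w)"
    note cO = outer_carrier[OF x]
    have "0 > Re (mat_tr (Y * reduction m n k ?O))"
      using neg[OF psd_outer[OF w(1)] nz] by (simp add: L_def congruence_outer[OF B w(1)])
    \<comment> \<open>Self-adjointness moves the ampliation from the rank one matrix to
      \<open>ptrace m n Y\<close>.\<close>
    moreover have "mat_tr (ampl n (ptrace m n Y) * ?O) = mat_tr (ptrace m n Y * ptrace m n ?O)"
      using mat_tr_comm[OF ampl_carrier[OF ptrace_carrier] cO]
        tr_mult_ampl[OF cO ptrace_carrier[of m n Y]] mat_tr_comm[OF ptrace_carrier[of m n ?O] ptrace_carrier[of m n Y]]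
      by simp
    ultimately show ?thesis
      by (simp add: qform_outer[OF cY x] qform_outer[OF ampl_carrier[OF ptrace_carrier] x] tr_mult_reduction[OF cY cO])
  qed
  then have "d * k < m" by (intro dim_bound_of_certificate[OF Y n d B inj])
  then show False using dk by simp
qed

section \<open>Staircase subspaces\<close>

text \<open>Column \<open>i\<close> of the staircase matrix is \<open>\<Sum>\<^sub>a \<surd>(weight k d i a) e\<^bsub>ik+a\<^esub> \<otimes> e\<^sub>a\<close> over \<open>a \<le> k\<close>. Columns \<open>i - 1\<close> and
  \<open>i\<close> share the row \<open>i k\<close> of the first factor; the two weights there add up to \<open>d\<close>, as does every other
  row up to \<open>d k\<close>.\<close>

definition weight :: "nat \<Rightarrow> nat \<Rightarrow> nat \<Rightarrow> nat \<Rightarrow> nat" where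
  "weight k d i a = (if a = 0 then d - i else if a = k then i + 1 else d)"

definition stair :: "nat \<Rightarrow> nat \<Rightarrow> nat \<Rightarrow> nat \<Rightarrow> complex mat" where
  "stair m n k d = mat (m * n) d (\<lambda>(r,i).
     if r mod n \<le> k \<and> r div n = i * k + r mod n then complex_of_real (sqrt (weight k d i (r mod n))) else 0)"

lemma stair_carrier [simp]: "stair m n k d \<in> carrier_mat (m * n) d"
  by (simp add: stair_def)

lemma stair_index:
  assumes "p < m" "a < n" "i < d"
  shows "stair m n k d $$ (p * n + a, i)
    = (if a \<le> k \<and> p = i * k + a then complex_of_real (sqrt (weight k d i a)) else 0)"
  using assms by (simp add: stair_def mat_index_less)

text \<open>The sum is \<open>(d - i) + (k - 1) * d + (i + 1)\<close>; \<open>1 \<le> k\<close>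
  keeps the two end positions distinct.\<close>

lemma sum_weight:
  assumes "1 \<le> k" "i < d"
  shows "(\<Sum>a\<le>k. weight k d i a) = d * k + 1"
proof -
  obtain l where k: "k = Suc l" using assms(1) by (cases k) auto
  have "(\<Sum>a\<le>k. weight k d i a) = weight k d i 0 + (\<Sum>a\<le>l. weight k d i (Suc a))"
    unfolding k by (rule sum.atMost_Suc_shift)
  also have "(\<Sum>a\<le>l. weight k d i (Suc a)) = (\<Sum>a<l. weight k d i (Suc a)) + weight k d i k"
    unfolding k lessThan_Suc_atMost[symmetric] by simp
  also have "(\<Sum>a<l. weight k d i (Suc a)) = (\<Sum>a<l. d)"
    by (intro sum.cong refl) (simp add: weight_def k)
  finally show ?thesis using assms by (simp add: weight_def k)
qed

text \<open>Distinct columns have disjoint supports, since \<open>i * k + a = j * k + a\<close>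
  forces \<open>i = j\<close>. The squared norm is \<open>sum_weight\<close>.\<close>

lemma stair_orthogonal:
  assumes k: "1 \<le> k" "k < n" and m: "d * k < m"
  shows "mat_adjoint (stair m n k d) * stair m n k d = of_nat (d * k + 1) \<cdot>\<^sub>m 1\<^sub>m d"
proof (rule eq_matI)
  let ?X = "stair m n k d"
  note dX = carrier_matD[OF stair_carrier[of m n k d]]
  show "dim_row (mat_adjoint ?X * ?X) = dim_row (of_nat (d * k + 1) \<cdot>\<^sub>m 1\<^sub>m d :: complex mat)"
    "dim_col (mat_adjoint ?X * ?X) = dim_col (of_nat (d * k + 1) \<cdot>\<^sub>m 1\<^sub>m d :: complex mat)"
    using dX by simp_all
  fix i j assume "i < dim_row (of_nat (d * k + 1) \<cdot>\<^sub>m 1\<^sub>m d :: complex mat)"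
    "j < dim_col (of_nat (d * k + 1) \<cdot>\<^sub>m 1\<^sub>m d :: complex mat)"
  then have ij: "i < d" "j < d" by simp_all
  have bound: "i * k + a < m" if "a \<le> k" for a
  proof -
    have "i * k + a \<le> Suc i * k" using that by simp
    also have "\<dots> \<le> d * k" using ij by (intro mult_le_mono1) simp
    finally show ?thesis using m by simp
  qed
  have "(mat_adjoint ?X * ?X) $$ (i,j) = (\<Sum>r<m*n. cnj (?X $$ (r,i)) * ?X $$ (r,j))"
    using dX ij by (simp add: scalar_prod_def atLeast0LessThan)
  also have "\<dots> = (\<Sum>p<m. \<Sum>a<n. cnj (?X $$ (p*n+a,i)) * ?X $$ (p*n+a,j))"
    by (rule sum_block_index)
  also have "\<dots> = (\<Sum>p<m. \<Sum>a<n. if p = i * k + a then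
      (if a \<le> k \<and> i = j then of_nat (weight k d i a) else 0) else 0)"
    using k by (intro sum.cong refl)
      (auto simp: stair_index ij of_real_mult[symmetric] simp del: of_real_mult)
  also have "\<dots> = (\<Sum>a<n. \<Sum>p<m. if p = i * k + a then
      (if a \<le> k \<and> i = j then of_nat (weight k d i a) else 0) else 0)"
    by (rule sum.swap)
  also have "\<dots> = (\<Sum>a<n. if a \<le> k then (if i = j then of_nat (weight k d i a) else 0) else 0)"
    using bound by (intro sum.cong refl) auto
  also have "\<dots> = (\<Sum>a\<le>k. if i = j then of_nat (weight k d i a) else 0)"
    using k by (intro sum.mono_neutral_cong_right) auto
  also have "\<dots> = (of_nat (d * k + 1) \<cdot>\<^sub>m 1\<^sub>m d) $$ (i,j)"
    using ij arg_cong[OF sum_weight[OF k(1) ij(1)], of "of_nat :: nat \<Rightarrow> complex"]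
    by (cases "i = j") simp_all
  finally show "(mat_adjoint ?X * ?X) $$ (i,j) = (of_nat (d * k + 1) \<cdot>\<^sub>m 1\<^sub>m d) $$ (i,j)" .
qed

text \<open>Write \<open>p = u * k + v\<close> with \<open>v < k\<close>. Only column
  \<open>u\<close> meets row \<open>p\<close>, together with column \<open>u - 1\<close> when
  \<open>v = 0\<close>; in that case the weights are \<open>d - u\<close> and
  \<open>u\<close>.\<close>

lemma sum_weight_row:
  assumes k: "1 \<le> k"
  shows "(\<Sum>i<d. if i * k \<le> p \<and> p - i * k \<le> k then weight k d i (p - i * k) else 0) \<le> d" (is "sum ?g _ \<le> _")
proof -
  define u v where "u = p div k" and "v = p mod k"
  have p: "p = u * k + v" and v: "v < k" using k by (auto simp: u_def v_def)
  \<comment> \<open>The guard \<open>1 \<le> u\<close> matters because truncated subtraction makes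
    \<open>u - 1\<close> equal to 0 at \<open>u = 0\<close>, where there is no previous
    column.\<close>
  have g: "?g i \<le> (if i = u then if v = 0 then d - u else d else 0)
      + (if i = u - 1 then if v = 0 \<and> 1 \<le> u then u else 0 else 0)" for i
  proof (cases "i * k \<le> p \<and> p - i * k \<le> k")
    case True
    then have le: "i * k \<le> u * k + v" "u * k + v \<le> Suc i * k" using p by auto
    have "i * k < Suc u * k" using le v by simp
    then have "i \<le> u" by (simp only: mult_less_cancel2 less_Suc_eq_le)
    moreover have "u * k \<le> Suc i * k" using le by simp
    then have "u \<le> Suc i" using k by (simp only: mult_le_cancel2)
    ultimately consider "i = u" | "u = Suc i" by linarith
    then show ?thesis
    proof cases
      case 1
      then have "p - i * k = v" using p by simp
      then show ?thesis using 1 v k by (auto simp: weight_def)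
    next
      case 2
      then have v0: "v = 0" using le by simp
      then have "p - i * k = k" using p 2 by simp
      then show ?thesis using 2 v0 k by (simp add: weight_def)
    qed
  qed auto
  have "sum ?g {..<d} \<le> (\<Sum>i<d. (if i = u then if v = 0 then d - u else d else 0)
      + (if i = u - 1 then if v = 0 \<and> 1 \<le> u then u else 0 else 0))"
    by (intro sum_mono g)
  also have "\<dots> \<le> d" by (auto simp: sum.distrib)
  finally show ?thesis .
qed

text \<open>For a fixed column and second index only one first index carries an entry, so the
  partial trace is diagonal; its diagonal entries are the row sums of weights.\<close>

lemma ptrace_stair:
  assumes k: "1 \<le> k" "k < n" and pq: "p < m" "q < m"
  shows "\<exists>c::nat. c \<le> d \<and>
    ptrace m n (stair m n k d * mat_adjoint (stair m n k d)) $$ (p,q) = (if p = q then of_nat c else 0)"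
proof -
  let ?X = "stair m n k d"
  note dX = carrier_matD[OF stair_carrier[of m n k d]]
  let ?c = "\<Sum>i<d. if i * k \<le> p \<and> p - i * k \<le> k then weight k d i (p - i * k) else 0"
  have "ptrace m n (?X * mat_adjoint ?X) $$ (p,q) = (\<Sum>a<n. (?X * mat_adjoint ?X) $$ (p*n+a, q*n+a))"
    by (rule ptrace_index[OF pq])
  also have "\<dots> = (\<Sum>a<n. \<Sum>i<d. ?X $$ (p*n+a,i) * cnj (?X $$ (q*n+a,i)))"
    using dX pq by (intro sum.cong refl) (simp add: scalar_prod_def atLeast0LessThan mat_index_less)
  also have "\<dots> = (\<Sum>a<n. \<Sum>i<d. if a \<le> k \<and> p = i * k + a \<and> p = q then of_nat (weight k d i a) else 0)"
    using k pq by (intro sum.cong refl)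
      (auto simp: stair_index of_real_mult[symmetric] simp del: of_real_mult)
  also have "\<dots> = (\<Sum>i<d. \<Sum>a<n. if a \<le> k \<and> p = i * k + a \<and> p = q then of_nat (weight k d i a) else 0)"
    by (rule sum.swap)
  also have "\<dots> = (\<Sum>i<d. \<Sum>a<n. if a = p - i * k then
      (if i * k \<le> p \<and> p - i * k \<le> k \<and> p = q then of_nat (weight k d i (p - i * k)) else 0) else 0)"
    by (intro sum.cong refl) auto
  also have "\<dots> = (\<Sum>i<d. if i * k \<le> p \<and> p - i * k \<le> k \<and> p = q then of_nat (weight k d i (p - i * k)) else 0)"
    using k by (intro sum.cong refl) auto
  also have "\<dots> = (if p = q then of_nat ?c else 0)"
    by (auto simp: of_nat_sum intro!: sum.cong)
  finally show ?thesis using sum_weight_row[OF k(1)] by blast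
qed

lemma stair_injective:
  assumes k: "1 \<le> k" "k < n" and m: "d * k < m"
    and w: "w \<in> carrier_vec d" "stair m n k d *\<^sub>v w = 0\<^sub>v (m * n)"
  shows "w = 0\<^sub>v d"
proof -
  let ?X = "stair m n k d"
  have cX: "mat_adjoint ?X \<in> carrier_mat d (m * n)" by simp
  have "(of_nat (d * k + 1) \<cdot>\<^sub>m 1\<^sub>m d) *\<^sub>v w = mat_adjoint ?X *\<^sub>v (?X *\<^sub>v w)"
    unfolding stair_orthogonal[OF k m, symmetric] by (rule assoc_mult_mat_vec[OF cX stair_carrier w(1)])
  also have "\<dots> = 0\<^sub>v d" unfolding w(2) by (rule eq_vecI) (use carrier_matD[OF cX] in auto)
  finally have "(of_nat (d * k + 1) \<cdot>\<^sub>m 1\<^sub>m d) *\<^sub>v w = 0\<^sub>v d" .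
  moreover have "(of_nat (d * k + 1) \<cdot>\<^sub>m 1\<^sub>m d) *\<^sub>v w = of_nat (d * k + 1) \<cdot>\<^sub>v w"
    using w(1) by (intro eq_vecI) auto
  ultimately have e: "of_nat (d * k + 1) \<cdot>\<^sub>v w = 0\<^sub>v d" by simp
  show ?thesis
  proof (rule eq_vecI)
    fix i assume "i < dim_vec (0\<^sub>v d :: complex vec)"
    then have i: "i < d" by simp
    then have "of_nat (d * k + 1) * w $ i = (of_nat (d * k + 1) \<cdot>\<^sub>v w) $ i" using w(1) by simp
    also have "\<dots> = 0" unfolding e using i by simp
    finally have "w $ i = 0" unfolding mult_eq_0_iff of_nat_eq_0_iff by simp
    then show "w $ i = 0\<^sub>v d $ i" using i by simp
  qed (use w in auto)
qed

lemma mult_unit_vec_diag: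
  fixes A :: "complex mat"
  assumes "A \<in> carrier_mat N N" "i < N"
  shows "(A *\<^sub>v unit_vec N i) $ i = A $$ (i,i)"
  using assms by auto

lemma stair_detecting:
  assumes k: "1 \<le> k" "k < n" and m: "d * k < m"
  shows "detecting_subspace m n (R_map k n) (mat_range (stair m n k d))"
  unfolding detecting_subspace_def
proof (intro conjI allI impI notI)
  let ?N = "m * n"
  let ?X = "stair m n k d"
  show "is_subspace ?N (mat_range ?X)"
    by (rule injective_imp_subspace_dim(1)[OF stair_carrier stair_injective[OF k m]])
  fix \<rho> assume \<rho>: "density_mat ?N \<rho> \<and> mat_range \<rho> \<subseteq> mat_range ?X"
    and psd: "psd_mat ?N (id_tensor m n (R_map k n) \<rho>)"
  have p\<rho>: "psd_mat ?N \<rho>" and tr\<rho>: "mat_tr \<rho> = 1" using \<rho> by (auto simp: density_mat_def)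
  have c\<rho>: "\<rho> \<in> carrier_mat ?N ?N" using p\<rho> by (rule psd_carrier)
  have cX: "mat_adjoint ?X \<in> carrier_mat d ?N" by simp
  define Y where "Y = ?X * mat_adjoint ?X"
  have cY: "Y \<in> carrier_mat ?N ?N" unfolding Y_def by (rule mult_carrier_mat[OF stair_carrier cX])
  let ?R = "reduction m n k \<rho>"
  have R: "psd_mat ?N ?R" using psd unfolding reduction_def id_tensor_R_map[OF c\<rho>] .
  note cR = psd_carrier[OF R]
  have "0 \<le> Re (mat_tr (mat_adjoint ?X * ?R * ?X))"
    by (rule psd_tr_nonneg[OF psd_congruence[OF R stair_carrier]])
  also have "mat_tr (mat_adjoint ?X * ?R * ?X) = mat_tr (?X * (mat_adjoint ?X * ?R))"
    by (rule mat_tr_comm[OF mult_carrier_mat[OF cX cR] stair_carrier])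
  also have "?X * (mat_adjoint ?X * ?R) = Y * ?R"
    unfolding Y_def using assoc_mult_mat[OF stair_carrier cX cR] by simp
  finally have nonneg: "0 \<le> Re (mat_tr (Y * ?R))" .

  \<comment> \<open>On the range of \<open>?X\<close>, which contains the columns of
    \<open>\<rho>\<close>, \<open>Y\<close> acts as multiplication by
    \<open>d * k + 1\<close>.\<close>
  have "(Y * \<rho>) $$ (i,i) = of_nat (d * k + 1) * \<rho> $$ (i,i)" if i: "i < ?N" for i
  proof -
    have u: "(unit_vec ?N i :: complex vec) \<in> carrier_vec ?N" by simp
    have "\<rho> *\<^sub>v unit_vec ?N i \<in> mat_range \<rho>" 
      unfolding mat_range_def carrier_matD(2)[OF c\<rho>] by (intro imageI u)
    then have "\<rho> *\<^sub>v unit_vec ?N i \<in> mat_range ?X" using \<rho> by blast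
    then obtain w where w: "w \<in> carrier_vec d" "\<rho> *\<^sub>v unit_vec ?N i = ?X *\<^sub>v w"
      unfolding mat_range_def carrier_matD(2)[OF stair_carrier[of m n k d]] by blast
    have Xw: "?X *\<^sub>v w \<in> carrier_vec ?N" by (rule mult_mat_vec_carrier[OF stair_carrier w(1)])
    have "(Y * \<rho>) *\<^sub>v unit_vec ?N i = Y *\<^sub>v (?X *\<^sub>v w)"
      using assoc_mult_mat_vec[OF cY c\<rho> u] w(2) by simp
    also have "\<dots> = ?X *\<^sub>v (mat_adjoint ?X *\<^sub>v (?X *\<^sub>v w))"
      unfolding Y_def by (rule assoc_mult_mat_vec[OF stair_carrier cX Xw])
    also have "mat_adjoint ?X *\<^sub>v (?X *\<^sub>v w) = (of_nat (d * k + 1) \<cdot>\<^sub>m 1\<^sub>m d) *\<^sub>v w"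
      unfolding stair_orthogonal[OF k m, symmetric] by (rule assoc_mult_mat_vec[OF cX stair_carrier w(1), symmetric])
    also have "\<dots> = of_nat (d * k + 1) \<cdot>\<^sub>v w" using w(1) by (intro eq_vecI) auto
    also have "?X *\<^sub>v \<dots> = of_nat (d * k + 1) \<cdot>\<^sub>v (\<rho> *\<^sub>v unit_vec ?N i)"
      unfolding w(2) by (rule mult_mat_vec[OF stair_carrier w(1)])
    finally have "((Y * \<rho>) *\<^sub>v unit_vec ?N i) $ i = (of_nat (d * k + 1) \<cdot>\<^sub>v (\<rho> *\<^sub>v unit_vec ?N i)) $ i" by simp
    also have "\<dots> = of_nat (d * k + 1) * \<rho> $$ (i,i)"
      using i c\<rho> mult_unit_vec_diag[OF c\<rho> i] by simp
    finally show ?thesis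
      unfolding mult_unit_vec_diag[OF mult_carrier_mat[OF cY c\<rho>] i] .
  qed
  then have "mat_tr (Y * \<rho>) = of_nat (d * k + 1) * mat_tr \<rho>"
    using cY c\<rho> by (simp add: mat_tr_def sum_distrib_left del: of_nat_add of_nat_mult)
  then have trY: "mat_tr (Y * \<rho>) = of_nat (d * k + 1)" by (simp only: tr\<rho> mult_1_right)

  let ?A = "ptrace m n \<rho>"
  have diag: "0 \<le> Re (?A $$ (p,p))" if "p < m" for p
    using that by (auto simp: ptrace_index mat_index_less intro!: sum_nonneg psd_diag_nonneg[OF p\<rho>])
  have row: "Re (\<Sum>q<m. ptrace m n Y $$ (p,q) * ?A $$ (q,p)) \<le> real d * Re (?A $$ (p,p))" if p: "p < m" for p
  proof -
    obtain c where c: "c \<le> d" "ptrace m n Y $$ (p,p) = of_nat c"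
      using ptrace_stair[OF k p p, of d] unfolding Y_def by auto
    have "ptrace m n Y $$ (p,q) = 0" if "q < m" "q \<noteq> p" for q
      using ptrace_stair[OF k p that(1), of d] that(2) unfolding Y_def by auto
    then have "(\<Sum>q<m. ptrace m n Y $$ (p,q) * ?A $$ (q,p)) = (\<Sum>q<m. if q = p then of_nat c * ?A $$ (p,p) else 0)"
      using c(2) by (intro sum.cong refl) auto
    also have "\<dots> = of_nat c * ?A $$ (p,p)" using p by simp
    finally show ?thesis using c(1) diag[OF p] by (simp add: mult_right_mono)
  qed
  have "Re (mat_tr (ptrace m n Y * ?A)) = (\<Sum>p<m. Re (\<Sum>q<m. ptrace m n Y $$ (p,q) * ?A $$ (q,p)))"
    unfolding mat_tr_mult[OF ptrace_carrier ptrace_carrier] by (rule Re_sum)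
  also have "\<dots> \<le> (\<Sum>p<m. real d * Re (?A $$ (p,p)))" by (intro sum_mono row) simp
  also have "\<dots> = real d * Re (mat_tr ?A)" 
    by (simp add: mat_tr_def sum_distrib_left carrier_matD[OF ptrace_carrier])
  also have "\<dots> = real d" by (simp add: tr_ptrace[OF c\<rho>] tr\<rho>)
  finally have "real k * Re (mat_tr (ptrace m n Y * ?A)) \<le> real k * real d" by (intro mult_left_mono) auto
  \<comment> \<open>The trace of \<open>Y * ?R\<close> is at most
    \<open>k * d - (d * k + 1) = -1\<close>.\<close>
  then show False
    using nonneg by (simp add: tr_mult_reduction[OF cY c\<rho>] trY mult.commute)
qed

section \<open>The values of \<open>nu_m\<close> and \<open>nu\<close>\<close>

lemma nu_m_R_map:
  assumes k: "1 \<le> k" "k < n" and m: "1 \<le> m"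
  shows "nu_m m n (R_map k n) = (m - 1) div k"
proof -
  let ?D = "{subspace_dim (m * n) S | S. detecting_subspace m n (R_map k n) S}"
  let ?d = "(m - 1) div k"
  \<comment> \<open>\<open>?d\<close> is the largest \<open>d\<close> with \<open>d * k < m\<close>,
    the condition common to both bounds.\<close>
  have dk: "?d * k < m"
  proof -
    have "?d * k \<le> m - 1" by (rule div_times_less_eq_dividend)
    also have "\<dots> < m" using m by simp
    finally show ?thesis .
  qed
  have "Max ?D = ?d"
  proof (rule Max_eqI[OF finite_detecting_dims])
    fix y assume "y \<in> ?D"
    then obtain S where S: "y = subspace_dim (m * n) S" "detecting_subspace m n (R_map k n) S" by blast
    have "y * k < m" unfolding S(1) using k m by (intro detecting_dim_bound[OF S(2)]) auto
    then have "y * k \<le> m - 1" by simp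
    then show "y \<le> ?d" using k by (simp add: less_eq_div_iff_mult_less_eq)
  next
    show "?d \<in> ?D"
    proof (intro CollectI exI conjI)
      show "detecting_subspace m n (R_map k n) (mat_range (stair m n k ?d))"
        by (rule stair_detecting[OF k dk])
      show "?d = subspace_dim (m * n) (mat_range (stair m n k ?d))"
        by (rule injective_imp_subspace_dim(2)[OF stair_carrier stair_injective[OF k dk], symmetric])
    qed
  qed
  then show ?thesis by (simp add: nu_m_def)
qed

text \<open>Dividing \<open>m - 1\<close> rather than \<open>m\<close> gives the right value at
  multiples of \<open>k\<close>: the quotient \<open>?q\<close> satisfies \<open>?q * k < m\<close>
  and \<open>m \<le> (?q + 1) * k\<close>.\<close>

lemma ceiling_div_nat:
  assumes "1 \<le> k" "1 \<le> m"
  shows "int ((m - 1) div k) = \<lceil>real m / real k\<rceil> - 1"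
proof -
  let ?q = "(m - 1) div k"
  have "?q * k + (m - 1) mod k = m - 1" by (rule div_mult_mod_eq)
  moreover have "(m - 1) mod k < k" using assms by simp
  moreover have "(?q + 1) * k = ?q * k + k" by simp
  ultimately have "?q * k < m" "m \<le> (?q + 1) * k" using assms(2) by linarith+
  then have "real ?q * real k < real m" "real m \<le> (real ?q + 1) * real k"
    by (metis of_nat_less_iff of_nat_mult, metis of_nat_le_iff of_nat_mult of_nat_add of_nat_1)
  then have "real ?q < real m / real k" "real m / real k \<le> real ?q + 1"
    using assms by (auto simp: field_simps)
  then have "\<lceil>real m / real k\<rceil> = int ?q + 1" by (intro ceiling_unique) auto
  then show ?thesis by simp
qed

theorem theorem2:
  fixes k n m :: nat
  assumes "1 \<le> k" and "k < n" and "1 \<le> m"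
  shows "int (nu_m m n (R_map k n)) = \<lceil>real m / real k\<rceil> - 1 \<and> nu n (R_map k n) = 1 / real k"
proof
  have nu_m: "int (nu_m j n (R_map k n)) = \<lceil>real j / real k\<rceil> - 1" if "1 \<le> j" for j
    using nu_m_R_map[OF assms(1,2) that] ceiling_div_nat[OF assms(1) that] by simp
  then show "int (nu_m m n (R_map k n)) = \<lceil>real m / real k\<rceil> - 1" using assms(3) .
  have "(\<lambda>j. real (nu_m j n (R_map k n)) / real j) \<longlonglongrightarrow> 1 / real k"
  proof (rule real_tendsto_sandwich)
    show "(\<lambda>j. 1 / real k - 1 / real j) \<longlonglongrightarrow> 1 / real k"
      using tendsto_diff[OF tendsto_const lim_1_over_n] by simp
    show "(\<lambda>j. 1 / real k) \<longlonglongrightarrow> 1 / real k" by simp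
    \<comment> \<open>Rounding up and subtracting 1 moves \<open>real j / real k\<close> down by at
      most 1, an error that vanishes after division by \<open>j\<close>.\<close>
    have bounds: "real j / real k - 1 \<le> real (nu_m j n (R_map k n)) \<and>
        real (nu_m j n (R_map k n)) \<le> real j / real k" if "1 \<le> j" for j
    proof -
      have "real (nu_m j n (R_map k n)) = real_of_int (int (nu_m j n (R_map k n)))" by simp
      also have "\<dots> = real_of_int \<lceil>real j / real k\<rceil> - 1" unfolding nu_m[OF that] by simp
      finally show ?thesis by linarith
    qed
    show "\<forall>\<^sub>F j in sequentially. 1 / real k - 1 / real j \<le> real (nu_m j n (R_map k n)) / real j"
      using eventually_ge_at_top[of 1]
    proof eventually_elim
      case (elim j)
      then have "(real j / real k - 1) / real j \<le> real (nu_m j n (R_map k n)) / real j"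
        using bounds by (intro divide_right_mono) auto
      then show ?case using elim by (simp add: diff_divide_distrib)
    qed
    show "\<forall>\<^sub>F j in sequentially. real (nu_m j n (R_map k n)) / real j \<le> 1 / real k"
      using eventually_ge_at_top[of 1]
    proof eventually_elim
      case (elim j)
      then have "real (nu_m j n (R_map k n)) / real j \<le> (real j / real k) / real j"
        using bounds by (intro divide_right_mono) auto
      then show ?case using elim by simp
    qed
  qed
  then show "nu n (R_map k n) = 1 / real k" unfolding nu_def by (rule limI)
qed

end
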